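(* Let $G$ be a connected finite simple graph with maximum degree $\Delta(G)$. Then $\chi_{D_L}(G)\leq 2\Delta(G)-1$, unless $G$ is the complete bipartite graph $K_{\Delta(G),\Delta(G)}$ or the cycle $C_6$. In these two cases, $\chi_{D_L}(G)=2\Delta(G)$.
   Context: A vertex coloring $f$ of a graph $G$ is distinguishing if the only automorphism $\phi$ of $G$ with $f(\phi(v))=f(v)$ for all vertices $v$ is the identity. A list assignment $L=\{L(v)\}_{v\in V(G)}$ assigns to each vertex a finite set of colors; $G$ is properly $L$-distinguishable if there is a proper vertex coloring $f$ of $G$ which is distinguishing and satisfies $f(v)\in L(v)$ for all $v$. The list-distinguishing chromatic number $\chi_{D_L}(G)$ is the minimum integer $k$ such that $G$ is properly $L$-distinguishable for every list assignment $L$ with $|L(v)|=k$ for all $v\in V(G)$. $C_6$ is the cycle on six vertices and $K_{m,m}$ the complete bipartite graph with both parts of size $m$.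
   Formalization: The graph is assumed to have maximum degree at least 1; this excludes only the one-vertex graph, for which the list-distinguishing chromatic number is 1 while 2Δ−1 = −1, so the stated bound fails there. *)

theory Defs
  imports "Graph_Theory.Graph_Theory"
begin

text \<open>
  A finite simple graph is a \<open>pair_graph\<close>: a finite vertex set with a symmetric, irreflexive
  adjacency relation, each edge being represented by its two opposite arcs.  The out-degree is
  therefore the degree, and an automorphism is determined by its action on the vertices.
\<close>

definition max_degree :: "'a pair_pre_digraph \<Rightarrow> nat" where
  "max_degree G = Max (out_degree (with_proj G) ` pverts G)"

definition graph_automorphism :: "'a pair_pre_digraph \<Rightarrow> ('a \<Rightarrow> 'a) \<Rightarrow> bool" where
  "graph_automorphism G \<phi> \<longleftrightarrow> bij_betw \<phi> (pverts G) (pverts G) \<and>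
    (\<forall>u\<in>pverts G. \<forall>v\<in>pverts G. (u, v) \<in> parcs G \<longleftrightarrow> (\<phi> u, \<phi> v) \<in> parcs G)"

definition proper_coloring :: "'a pair_pre_digraph \<Rightarrow> ('a \<Rightarrow> 'c) \<Rightarrow> bool" where
  "proper_coloring G f \<longleftrightarrow> (\<forall>(u, v)\<in>parcs G. f u \<noteq> f v)"

definition distinguishing :: "'a pair_pre_digraph \<Rightarrow> ('a \<Rightarrow> 'c) \<Rightarrow> bool" where
  "distinguishing G f \<longleftrightarrow>
    (\<forall>\<phi>. graph_automorphism G \<phi> \<and> (\<forall>v\<in>pverts G. f (\<phi> v) = f v) \<longrightarrow> (\<forall>v\<in>pverts G. \<phi> v = v))"

definition properly_L_distinguishable ::
    "'a pair_pre_digraph \<Rightarrow> ('a \<Rightarrow> 'c set) \<Rightarrow> bool" where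
  "properly_L_distinguishable G L \<longleftrightarrow>
    (\<exists>f. proper_coloring G f \<and> distinguishing G f \<and> (\<forall>v\<in>pverts G. f v \<in> L v))"

text \<open>
  Colors are natural numbers.  On a finite graph, finite lists use only finitely many colors in
  total, so any other infinite supply of colors gives the same number.
\<close>

definition list_dist_chromatic_number :: "'a pair_pre_digraph \<Rightarrow> nat" where
  "list_dist_chromatic_number G = (LEAST k. \<forall>L :: 'a \<Rightarrow> nat set.
    (\<forall>v\<in>pverts G. finite (L v) \<and> card (L v) = k) \<longrightarrow> properly_L_distinguishable G L)"

definition cycle_graph :: "nat \<Rightarrow> nat pair_pre_digraph" where
  "cycle_graph n = \<lparr> pverts = {..<n},
    parcs = {(i, j). i < n \<and> j < n \<and> (j = Suc i mod n \<or> i = Suc j mod n)} \<rparr>"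

end

theory Submission
  imports Defs
begin

text \<open>
  Color the graph outwards from a root, always giving the uncolored neighbors of some already colored
  vertex pairwise distinct colors. A color preserving automorphism that fixes the root then
  fixes everything, so only the root must be recognisable. By greedy counting, \<open>2\<Delta> - 1\<close> colors
  are just enough for this; the color of the root can additionally be avoided when there is one
  more color, or when the root has degree below \<open>\<Delta>\<close> and only vertices of that same degree
  avoid it.

  In a \<open>\<Delta>\<close>-regular graph with \<open>\<Delta> \<ge> 3\<close>, avoiding the color of the root can only fail when
  every colored vertex with uncolored neighbors has exactly one colored neighbor, and its uncolored
  neighbors have all their neighbors colored. A vertex \<open>y\<close> that must then reuse the color of the
  root \<open>r\<close> is told apart from it by the set of colors around it: some neighbor of \<open>y\<close>
  that is not a neighbor of \<open>r\<close> can be recolored to make the two sets differ, and if there is no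
  such neighbor for any choice of \<open>y\<close>, the graph is \<open>K\<^bsub>\<Delta>,\<Delta>\<^esub>\<close>.

  On a cycle, two adjacent vertices with different lists give a color that can be kept unique to one
  of them; if all lists are equal, the colorings \<open>0(12)\<^sup>*\<close> and \<open>0120(12)\<^sup>*\<close> work for odd length and
  for even length at least 8.
\<close>

section \<open>Greedy choice, counting, and three-colorings of the hexagon\<close>

text \<open>Representatives are picked one at a time: when an element of \<open>D\<close> is
  treated, the earlier ones have used fewer than \<open>card D\<close> values.\<close>

lemma injective_choice:
  assumes "finite D" "\<And>v. v \<in> D \<Longrightarrow> finite (A v) \<and> card D \<le> card (A v)"
  shows "\<exists>g. inj_on g D \<and> (\<forall>v\<in>D. g v \<in> A v)"
  using assms
proof (induction D rule: finite_induct)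
  case empty
  then show ?case by simp
next
  case (insert x D)
  then have "\<forall>v\<in>D. finite (A v) \<and> card D \<le> card (A v)"
    by fastforce
  with insert obtain g where g: "inj_on g D" "\<forall>v\<in>D. g v \<in> A v"
    by blast
  have "card (g ` D) < card (A x)"
    using insert.prems[of x] insert.hyps card_image_le[of D g] by fastforce
  then obtain a where a: "a \<in> A x" "a \<notin> g ` D"
    using card_mono[of "g ` D" "A x"] insert.hyps by fastforce
  have "inj_on (g(x := a)) (insert x D)"
    using g a insert.hyps by (auto simp: inj_on_def)
  moreover have "\<forall>v\<in>insert x D. (g(x := a)) v \<in> A v"
    using g a insert.hyps by auto
  ultimately show ?case by blast
qed

text \<open>The saving of one color in the main bound starts here. All elements but \<open>y\<close>
  only compete among \<open>card D - 1\<close> elements, so their sets may be one smaller;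
  \<open>y\<close> is served last and needs the full size.\<close>

lemma injective_choice_last:
  assumes "finite D" "y \<in> D" "finite (A y)" "card D \<le> card (A y)"
    and "\<And>v. v \<in> D - {y} \<Longrightarrow> finite (A v) \<and> card D \<le> Suc (card (A v))"
  shows "\<exists>g. inj_on g D \<and> (\<forall>v\<in>D. g v \<in> A v)"
proof -
  define n where "n = card (D - {y})"
  have cD: "card D = Suc n"
    using card_Suc_Diff1[OF assms(1,2)] by (simp add: n_def)
  have "\<exists>g. inj_on g (D - {y}) \<and> (\<forall>v\<in>D - {y}. g v \<in> A v)"
  proof (rule injective_choice)
    show "finite (A v) \<and> card (D - {y}) \<le> card (A v)" if "v \<in> D - {y}" for v
      using assms(5)[OF that] unfolding cD n_def[symmetric] by simp
  qed (use assms in simp)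
  then obtain g where g: "inj_on g (D - {y})" "\<forall>v\<in>D - {y}. g v \<in> A v"
    by blast
  have "card (g ` (D - {y})) < card (A y)"
    using assms(1,4) card_image_le[of "D - {y}" g] unfolding cD n_def[symmetric] by simp
  then obtain a where a: "a \<in> A y" "a \<notin> g ` (D - {y})"
    using card_mono[of "g ` (D - {y})" "A y"] assms(1) by fastforce
  have "inj_on (g(y := a)) D"
    using g a by (auto simp: inj_on_def)
  moreover have "\<forall>v\<in>D. (g(y := a)) v \<in> A v"
    using g a by auto
  ultimately show ?thesis by blast
qed

text \<open>Counts the colors left after excluding those of the colored neighbors \<open>B\<close>
  and an extra set \<open>C\<close>; the additive form avoids truncated subtraction.\<close>

lemma card_avoiding:
  assumes "finite B" "finite C" "finite X" "card B + card C \<le> m"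
  shows "card X \<le> m + card (X - f ` B - C)"
proof -
  have "card X \<le> card (X - f ` B) + card (f ` B)"
    using diff_card_le_card_Diff[of "f ` B" X] assms by simp
  moreover have "card (X - f ` B) \<le> card (X - f ` B - C) + card C"
    using diff_card_le_card_Diff[of C "X - f ` B"] assms by simp
  moreover have "card (f ` B) \<le> card B"
    using assms by (simp add: card_image_le)
  ultimately show ?thesis using assms by linarith
qed

text \<open>With \<open>a\<close> to \<open>f\<close> around a hexagon, the disjuncts are invariance
  under the reflections fixing \<open>a\<close> and \<open>d\<close>, \<open>b\<close> and
  \<open>e\<close>, \<open>c\<close> and \<open>f\<close>, and under the half turn. Hence three
  colors never distinguish a hexagon.\<close>

lemma three_coloring_of_hexagon_symmetric:
  fixes a b c d e f :: nat
  assumes "a < 3" "b < 3" "c < 3" "d < 3" "e < 3" "f < 3"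
    and "a \<noteq> b" "b \<noteq> c" "c \<noteq> d" "d \<noteq> e" "e \<noteq> f" "f \<noteq> a"
  shows "b = f \<and> c = e \<or> a = c \<and> f = d \<or> b = d \<and> a = e \<or> a = d \<and> b = e \<and> c = f"
proof -
  \<comment> \<open>With three colors, a color different from two distinct ones is
    determined.\<close>
  have third: "z = w" if "x \<noteq> y" "z \<noteq> x" "z \<noteq> y" "w \<noteq> x" "w \<noteq> y"
    "x < 3" "y < 3" "z < 3" "w < 3" for x y z w :: nat
    using that by linarith
  show ?thesis
    using assms third by metis
qed

section \<open>Neighborhoods, connectivity and automorphisms\<close>

locale connected_pair_graph = pair_graph +
  assumes connected_G: "Digraph_Component.connected (with_proj G)"
begin

definition nbrs :: "'a \<Rightarrow> 'a set" where
  "nbrs v = {u. (v, u) \<in> parcs G}"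

abbreviation max_deg :: nat where
  "max_deg \<equiv> max_degree G"

definition lists_of_size :: "nat \<Rightarrow> ('a \<Rightarrow> nat set) \<Rightarrow> bool" where
  "lists_of_size k L \<longleftrightarrow> (\<forall>v\<in>pverts G. finite (L v) \<and> card (L v) = k)"

lemma nbrs_sym: "u \<in> nbrs v \<longleftrightarrow> v \<in> nbrs u"
  using arcs_symmetric by (auto simp: nbrs_def)

lemma not_in_own_nbrs [simp]: "v \<notin> nbrs v"
  using pair_no_loops by (force simp: nbrs_def)

lemma nbrs_subset: "nbrs v \<subseteq> pverts G"
  using in_arcsD2 by (auto simp: nbrs_def)

lemma in_nbrsD: "u \<in> nbrs v \<Longrightarrow> u \<in> pverts G" "u \<in> nbrs v \<Longrightarrow> v \<in> pverts G"
  using in_arcsD1 in_arcsD2 by (auto simp: nbrs_def)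

lemma finite_nbrs [simp]: "finite (nbrs v)"
  using nbrs_subset pair_finite_verts finite_subset by blast

lemma out_degree_nbrs: "out_degree (with_proj G) v = card (nbrs v)"
proof -
  have "out_arcs (with_proj G) v = Pair v ` nbrs v"
    by (auto simp: nbrs_def out_arcs_def)
  then show ?thesis
    by (simp add: out_degree_def card_image inj_on_def)
qed

lemma max_deg_nbrs: "max_deg = Max ((\<lambda>v. card (nbrs v)) ` pverts G)"
  by (simp add: max_degree_def out_degree_nbrs)

lemma card_nbrs_le: "v \<in> pverts G \<Longrightarrow> card (nbrs v) \<le> max_deg"
  unfolding max_deg_nbrs using pair_finite_verts by (intro Max_ge) auto

lemma pverts_nonempty: "pverts G \<noteq> {}"
  using connected_G connected_conv by (metis with_proj_simps(1))

text \<open>The form in which connectivity enters all later arguments: since arcs are symmetric,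
  every vertex is reachable from \<open>s\<close>, and membership in \<open>S\<close> propagates
  along the walk.\<close>

lemma closed_under_nbrs:
  assumes "s \<in> S" "S \<subseteq> pverts G" "\<And>v. v \<in> S \<Longrightarrow> nbrs v \<subseteq> S"
  shows "S = pverts G"
proof -
  have sc: "strongly_connected (with_proj G)"
    using connected_G sym_arcs symmetric_connected_imp_strongly_connected by simp
  have "v \<in> S" if v: "v \<in> pverts G" for v
  proof -
    have "s \<rightarrow>\<^sup>*\<^bsub>with_proj G\<^esub> v"
      using sc v assms(1,2) unfolding strongly_connected_def with_proj_simps by blast
    then show ?thesis
    proof (induction rule: reachable_induct)
      case base
      then show ?case using assms by simp
    next
      case (step x y)
      then show ?case using assms(3)[of x] by (auto simp: nbrs_def)
    qed
  qed
  then show ?thesis using assms by blast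
qed

lemma boundary_vertex:
  assumes "s \<in> S" "S \<subset> pverts G"
  obtains p where "p \<in> S" "nbrs p - S \<noteq> {}"
proof -
  have "\<exists>p\<in>S. nbrs p - S \<noteq> {}"
  proof (rule ccontr)
    assume "\<not> ?thesis"
    then have "S = pverts G"
      using assms by (intro closed_under_nbrs[of s]) auto
    then show False using assms by simp
  qed
  then show ?thesis using that by blast
qed

lemma automorphism_image_nbrs:
  assumes "graph_automorphism G \<phi>" "v \<in> pverts G"
  shows "\<phi> ` nbrs v = nbrs (\<phi> v)"
proof
  show "\<phi> ` nbrs v \<subseteq> nbrs (\<phi> v)"
  proof
    fix w assume "w \<in> \<phi> ` nbrs v"
    then obtain u where u: "u \<in> nbrs v" "w = \<phi> u" by blast
    then have "u \<in> pverts G" using in_nbrsD by blast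
    then show "w \<in> nbrs (\<phi> v)"
      using assms u unfolding nbrs_def graph_automorphism_def by simp
  qed
  show "nbrs (\<phi> v) \<subseteq> \<phi> ` nbrs v"
  proof
    fix w assume w: "w \<in> nbrs (\<phi> v)"
    then have "w \<in> \<phi> ` pverts G"
      using assms(1) in_nbrsD(1)[OF w] unfolding graph_automorphism_def bij_betw_def by simp
    then obtain u where u: "u \<in> pverts G" "w = \<phi> u" by blast
    then have "u \<in> nbrs v"
      using assms w unfolding nbrs_def graph_automorphism_def by simp
    then show "w \<in> \<phi> ` nbrs v"
      using u by blast
  qed
qed

lemma automorphism_inj:
  assumes "graph_automorphism G \<phi>" "u \<in> pverts G" "v \<in> pverts G" "\<phi> u = \<phi> v"
  shows "u = v"
proof -
  have "inj_on \<phi> (pverts G)"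
    using assms(1) unfolding graph_automorphism_def bij_betw_def by (elim conjE)
  then show ?thesis using assms(2-4) by (simp add: inj_on_eq_iff)
qed

lemma automorphism_card_nbrs:
  assumes "graph_automorphism G \<phi>" "v \<in> pverts G"
  shows "card (nbrs (\<phi> v)) = card (nbrs v)"
proof -
  have "inj_on \<phi> (nbrs v)"
    using automorphism_inj[OF assms(1)] in_nbrsD(1) by (meson inj_onI)
  then show ?thesis
    using card_image[of \<phi> "nbrs v"] automorphism_image_nbrs[OF assms] by simp
qed

subsection \<open>Search trees and their colorings\<close>

text \<open>The root is left out because the value of \<open>par\<close> there has no
  meaning.\<close>

definition sibling_injective :: "'a \<Rightarrow> 'a set \<Rightarrow> ('a \<Rightarrow> 'a) \<Rightarrow> ('a \<Rightarrow> nat) \<Rightarrow> bool" where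
  "sibling_injective r S par f \<longleftrightarrow>
    (\<forall>u\<in>S - {r}. \<forall>v\<in>S - {r}. par u = par v \<and> f u = f v \<longrightarrow> u = v)"

text \<open>
  The last clause, that fixing the root fixes the whole tree, quantifies over all colorings that
  separate siblings, so it survives a recoloring of the tree.
\<close>

definition search_tree :: "'a \<Rightarrow> 'a set \<Rightarrow> ('a \<Rightarrow> 'a) \<Rightarrow> bool" where
  "search_tree r S par \<longleftrightarrow> r \<in> S \<and> S \<subseteq> pverts G \<and>
    (\<forall>v\<in>S - {r}. par v \<in> S \<inter> nbrs v \<and> nbrs (par v) \<subseteq> S \<and> (par v \<noteq> r \<longrightarrow> par (par v) \<noteq> v)) \<and>
    (\<forall>f \<phi>. sibling_injective r S par f \<and> graph_automorphism G \<phi> \<and>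
      (\<forall>v\<in>pverts G. f (\<phi> v) = f v) \<and> \<phi> r = r \<longrightarrow> (\<forall>v\<in>S. \<phi> v = v))"

lemma search_tree_fixes:
  assumes "search_tree r S par" "sibling_injective r S par f" "graph_automorphism G \<phi>"
    "\<forall>v\<in>pverts G. f (\<phi> v) = f v" "\<phi> r = r"
  shows "\<forall>v\<in>S. \<phi> v = v"
proof -
  have "\<forall>f \<phi>. sibling_injective r S par f \<and> graph_automorphism G \<phi> \<and>
      (\<forall>v\<in>pverts G. f (\<phi> v) = f v) \<and> \<phi> r = r \<longrightarrow> (\<forall>v\<in>S. \<phi> v = v)"
    using assms(1) unfolding search_tree_def by (elim conjE)
  from this[rule_format, of f \<phi>] show ?thesis using assms(2-5) by blast
qed

definition graft :: "('a \<Rightarrow> 'a) \<Rightarrow> 'a set \<Rightarrow> 'a \<Rightarrow> 'a \<Rightarrow> 'a" where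
  "graft par S p v = (if v \<in> nbrs p - S then p else par v)"

lemma search_tree_root: "r \<in> pverts G \<Longrightarrow> search_tree r {r} par"
  unfolding search_tree_def by blast

text \<open>If all of \<open>S\<close> is fixed, so is \<open>p\<close>, and the neighbors of
  \<open>p\<close> are permuted. By injectivity a new neighbor is sent to a new neighbor; the two
  are siblings of the same color, hence equal.\<close>

lemma search_tree_graft:
  assumes st: "search_tree r S par" and p: "p \<in> S"
  shows "search_tree r (S \<union> nbrs p) (graft par S p)"
proof -
  define par' where "par' = graft par S p"
  have old: "par' v = par v" if "v \<in> S" for v
    using that by (simp add: par'_def graft_def)
  have new: "par' v = p" if "v \<in> nbrs p - S" for v
    using that by (simp add: par'_def graft_def)
  have st': "r \<in> S" "S \<subseteq> pverts G"
    "\<And>v. v \<in> S - {r} \<Longrightarrow> par v \<in> S \<and> par v \<in> nbrs v \<and> nbrs (par v) \<subseteq> S \<and> (par v \<noteq> r \<longrightarrow> par (par v) \<noteq> v)"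
    "\<And>f \<phi> v. sibling_injective r S par f \<Longrightarrow> graph_automorphism G \<phi> \<Longrightarrow>
      (\<forall>v\<in>pverts G. f (\<phi> v) = f v) \<Longrightarrow> \<phi> r = r \<Longrightarrow> v \<in> S \<Longrightarrow> \<phi> v = v"
    using st unfolding search_tree_def by auto
  have par: "par' v \<in> (S \<union> nbrs p) \<inter> nbrs v \<and> nbrs (par' v) \<subseteq> S \<union> nbrs p \<and>
      (par' v \<noteq> r \<longrightarrow> par' (par' v) \<noteq> v)" if v: "v \<in> S \<union> nbrs p - {r}" for v
  proof (cases "v \<in> S")
    case True
    then show ?thesis using st'(3)[of v] v old by auto
  next
    case False
    then have D: "v \<in> nbrs p - S" using v by auto
    \<comment> \<open>The parent of \<open>p\<close> lies in \<open>S\<close> and the new child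
      \<open>v\<close> does not, so \<open>par'\<close> has no 2-cycle through
      \<open>v\<close>.\<close>
    have "p \<noteq> r \<Longrightarrow> par' p \<in> S" using old[OF p] st'(3)[of p] p by auto
    then show ?thesis using new[OF D] D p nbrs_sym by auto
  qed
  have fixed: "\<phi> v = v" if f: "sibling_injective r (S \<union> nbrs p) par' f" and \<phi>: "graph_automorphism G \<phi>"
      "\<forall>v\<in>pverts G. f (\<phi> v) = f v" "\<phi> r = r" and v: "v \<in> S \<union> nbrs p" for f \<phi> v
  proof -
    have "sibling_injective r S par f"
      using f old unfolding sibling_injective_def by auto
    then have S: "\<phi> v = v" if "v \<in> S" for v
      using st'(4) \<phi> that by blast
    show ?thesis
    proof (cases "v \<in> S")
      case False
      then have D: "v \<in> nbrs p - S" using v by auto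
      have vV: "v \<in> pverts G" using D in_nbrsD by blast
      have im: "\<phi> v \<in> nbrs p"
        using automorphism_image_nbrs[OF \<phi>(1), of p] S[OF p] p st'(2) D by auto
      show ?thesis
      proof (cases "\<phi> v \<in> S")
        case True
        then show ?thesis
          using S automorphism_inj[OF \<phi>(1), of "\<phi> v" v] vV st'(2) by auto
      next
        case False
        then have D': "\<phi> v \<in> nbrs p - S" using im by auto
        show ?thesis
          using f new[OF D] new[OF D'] D D' \<phi>(2) vV st'(1)
          unfolding sibling_injective_def by auto
      qed
    qed (rule S)
  qed
  show ?thesis
    unfolding search_tree_def par'_def[symmetric]
    using st'(1,2) nbrs_subset par fixed by blast
qed

text \<open>The clause \<open>nbrs r \<subseteq> S\<close> ensures that a vertex with neighbors
  outside \<open>S\<close> is not the root. It then has its parent inside \<open>S\<close>, and so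
  at most \<open>max_deg - 1\<close> new neighbors.\<close>

definition tree_coloring :: "('a \<Rightarrow> nat set) \<Rightarrow> 'a \<Rightarrow> 'a set \<Rightarrow> ('a \<Rightarrow> 'a) \<Rightarrow> ('a \<Rightarrow> nat) \<Rightarrow> bool" where
  "tree_coloring L r S par c \<longleftrightarrow> search_tree r S par \<and> nbrs r \<subseteq> S \<and> sibling_injective r S par c \<and>
    (\<forall>v\<in>S. c v \<in> L v) \<and> (\<forall>u\<in>S. \<forall>v\<in>S \<inter> nbrs u. c u \<noteq> c v)"

lemma tree_coloring_distinguishable:
  assumes tc: "tree_coloring L r (pverts G) par c"
    and root: "\<And>\<phi>. graph_automorphism G \<phi> \<Longrightarrow> (\<forall>v\<in>pverts G. c (\<phi> v) = c v) \<Longrightarrow> \<phi> r = r"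
  shows "properly_L_distinguishable G L"
proof -
  have "distinguishing G c"
    unfolding distinguishing_def
  proof (intro allI impI)
    fix \<phi> assume \<phi>: "graph_automorphism G \<phi> \<and> (\<forall>v\<in>pverts G. c (\<phi> v) = c v)"
    then have "\<phi> r = r" using root by blast
    then show "\<forall>v\<in>pverts G. \<phi> v = v"
      using tc \<phi> search_tree_fixes unfolding tree_coloring_def by metis
  qed
  moreover have "proper_coloring G c"
    using tc in_arcsD1 in_arcsD2 unfolding proper_coloring_def tree_coloring_def nbrs_def by fastforce
  moreover have "\<forall>v\<in>pverts G. c v \<in> L v"
    using tc unfolding tree_coloring_def by simp
  ultimately show ?thesis
    unfolding properly_L_distinguishable_def by blast
qed

lemma card_new_nbrs:
  assumes "search_tree r S par" "nbrs r \<subseteq> S" "p \<in> S" "nbrs p - S \<noteq> {}"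
  shows "p \<noteq> r" "card (nbrs p - S) < card (nbrs p)" "card (nbrs p - S) \<le> max_deg - 1"
proof -
  show p: "p \<noteq> r" using assms by auto
  have "par p \<in> nbrs p - (nbrs p - S)"
    using p assms unfolding search_tree_def by auto
  then show "card (nbrs p - S) < card (nbrs p)"
    by (intro psubset_card_mono) auto
  then show "card (nbrs p - S) \<le> max_deg - 1"
    using card_nbrs_le[of p] assms unfolding search_tree_def by fastforce
qed

text \<open>The greedy step. A new neighbor \<open>v\<close> of \<open>p\<close> must avoid its
  colored neighbors, the extra set \<open>B v\<close>, and its new siblings, whether adjacent or
  not. As \<open>y\<close> is colored last, the other siblings may be one color short.\<close>

lemma tree_coloring_extend:
  assumes tc: "tree_coloring L r S par c" and p: "p \<in> S" and y: "y \<in> nbrs p - S"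
    and L: "lists_of_size k L"
    and B: "\<And>v. v \<in> nbrs p - S \<Longrightarrow> finite (B v)"
    and last: "card (nbrs p - S) + card (nbrs y \<inter> S) + card (B y) \<le> k"
    and others: "\<And>v. v \<in> nbrs p - S - {y} \<Longrightarrow> card (nbrs p - S) + card (nbrs v \<inter> S) + card (B v) \<le> Suc k"
  obtains c' where "tree_coloring L r (S \<union> nbrs p) (graft par S p) c'"
    "\<And>v. v \<in> S \<Longrightarrow> c' v = c v" "\<And>v. v \<in> nbrs p - S \<Longrightarrow> c' v \<notin> B v"
proof -
  define A where "A v = L v - c ` (nbrs v \<inter> S) - B v" for v
  have fin: "finite (L v)" "card (L v) = k" if "v \<in> nbrs p" for v
    using that L in_nbrsD unfolding lists_of_size_def by auto
  have cA: "k \<le> card (nbrs v \<inter> S) + card (B v) + card (A v)" "finite (A v)"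
    if "v \<in> nbrs p - S" for v
    using card_avoiding[of "nbrs v \<inter> S" "B v" "L v" _ c] B[OF that] fin[of v] that
    unfolding A_def by auto
  have st: "search_tree r S par" "nbrs r \<subseteq> S" using tc unfolding tree_coloring_def by auto
  have "\<exists>g. inj_on g (nbrs p - S) \<and> (\<forall>v\<in>nbrs p - S. g v \<in> A v)"
  proof (rule injective_choice_last[of _ y])
    show "card (nbrs p - S) \<le> card (A y)"
      using cA(1)[OF y] last by linarith
    show "finite (A v) \<and> card (nbrs p - S) \<le> Suc (card (A v))" if "v \<in> nbrs p - S - {y}" for v
      using cA[of v] others[OF that] that by auto
  qed (use y cA in auto)
  then obtain g where g: "inj_on g (nbrs p - S)" "\<And>v. v \<in> nbrs p - S \<Longrightarrow> g v \<in> A v"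
    by blast
  define c' where "c' v = (if v \<in> S then c v else g v)" for v
  \<comment> \<open>A parent has all its neighbors in \<open>S\<close>, which \<open>p\<close> has
    not. So \<open>p\<close> has no children yet, and the new siblings have to differ only from each
    other.\<close>
  have par_ne: "par v \<noteq> p" if "v \<in> S - {r}" for v
    using st y that unfolding search_tree_def by blast
  have "sibling_injective r (S \<union> nbrs p) (graft par S p) c'"
    using tc par_ne g(1) unfolding tree_coloring_def sibling_injective_def graft_def c'_def inj_on_def
    by (auto split: if_splits)
  moreover have "c' u \<noteq> c' v" if uv: "u \<in> S \<union> nbrs p" "v \<in> S \<union> nbrs p" "v \<in> nbrs u" for u v
  proof -
    have avoid: "g w \<noteq> c x" if "w \<in> nbrs p - S" "x \<in> S" "x \<in> nbrs w" for w x
      using g(2)[OF that(1)] that(2,3) unfolding A_def by blast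
    have "u \<noteq> v" "u \<in> nbrs v" using uv nbrs_sym by auto
    moreover have "c u \<noteq> c v" if "u \<in> S" "v \<in> S"
      using tc that uv unfolding tree_coloring_def by blast
    ultimately show ?thesis
      using avoid[of u v] avoid[of v u] uv inj_onD[OF g(1), of u v] unfolding c'_def by auto
  qed
  moreover have "c' v \<in> L v" if "v \<in> S \<union> nbrs p" for v
    using tc g that unfolding tree_coloring_def c'_def A_def by auto
  ultimately have "tree_coloring L r (S \<union> nbrs p) (graft par S p) c'"
    using search_tree_graft[OF st(1) p] st(2) unfolding tree_coloring_def by auto
  moreover have "c' v = c v" if "v \<in> S" for v
    using that by (simp add: c'_def)
  moreover have "c' v \<notin> B v" if "v \<in> nbrs p - S" for v
    using g(2)[OF that] that unfolding c'_def A_def by auto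
  ultimately show ?thesis
    by (rule that)
qed

text \<open>The root is colored first, and its neighbors then need at most \<open>max_deg\<close>
  colors other than that one. That they are pairwise distinct is recorded separately, because the
  color set around the root is compared with others later.\<close>

lemma tree_coloring_start:
  assumes r: "r \<in> pverts G" and L: "lists_of_size k L" and k: "max_deg < k"
  obtains par c where "tree_coloring L r (insert r (nbrs r)) par c"
    "\<And>v. v \<in> nbrs r \<Longrightarrow> c v \<noteq> c r" "inj_on c (nbrs r)"
proof -
  have fin: "finite (L v)" "card (L v) = k" if "v \<in> pverts G" for v
    using that L unfolding lists_of_size_def by auto
  obtain c0 where c0: "c0 \<in> L r"
    using fin[OF r] k by fastforce
  have "\<exists>g. inj_on g (nbrs r) \<and> (\<forall>v\<in>nbrs r. g v \<in> L v - {c0})"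
  proof (rule injective_choice)
    fix v assume v: "v \<in> nbrs r"
    then have "finite (L v)" "card (L v) = k" using fin in_nbrsD by auto
    then have "k \<le> Suc (card (L v - {c0}))"
      by (simp add: card_Diff_singleton_if) linarith
    then show "finite (L v - {c0}) \<and> card (nbrs r) \<le> card (L v - {c0})"
      using card_nbrs_le[OF r] k \<open>finite (L v)\<close> by auto
  qed simp
  then obtain g where g: "inj_on g (nbrs r)" "\<forall>v\<in>nbrs r. g v \<in> L v - {c0}"
    by blast
  define c where "c = g(r := c0)"
  have c: "c r = c0" "\<And>v. v \<in> nbrs r \<Longrightarrow> c v = g v"
    by (auto simp: c_def)
  define par where "par = graft (\<lambda>_. r) {r} r"
  have "search_tree r (insert r (nbrs r)) par"
    using search_tree_graft[OF search_tree_root[OF r], of r "\<lambda>_. r"] by (simp add: par_def)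
  moreover have "sibling_injective r (insert r (nbrs r)) par c"
    using g(1) c unfolding sibling_injective_def inj_on_def by auto
  moreover have "\<forall>v\<in>insert r (nbrs r). c v \<in> L v"
    using g c c0 by auto
  moreover have "\<forall>u\<in>insert r (nbrs r). \<forall>v\<in>insert r (nbrs r) \<inter> nbrs u. c u \<noteq> c v"
  proof (intro ballI)
    fix u v assume "u \<in> insert r (nbrs r)" "v \<in> insert r (nbrs r) \<inter> nbrs u"
    moreover from this have "u \<noteq> v" by auto
    ultimately show "c u \<noteq> c v" using g c unfolding inj_on_def by fastforce
  qed
  ultimately have "tree_coloring L r (insert r (nbrs r)) par c"
    unfolding tree_coloring_def by auto
  moreover have "c v \<noteq> c r" if "v \<in> nbrs r" for v
    using that g c by auto
  moreover have "inj_on c (nbrs r)"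
    using g(1) c(2) by (simp add: inj_on_def)
  ultimately show ?thesis by (rule that)
qed

lemma grow_to_all:
  assumes "Inv S0 par0 c0" "\<And>S par c. Inv S par c \<Longrightarrow> S \<subseteq> pverts G"
    and step: "\<And>S par c. Inv S par c \<Longrightarrow> S \<noteq> pverts G \<Longrightarrow> \<exists>S' par' c'. S \<subset> S' \<and> Inv S' par' c'"
  obtains par c where "Inv (pverts G) par c"
proof -
  have "\<exists>par c. Inv (pverts G) par c" if "Inv S par c" for S par c
    using that
  proof (induction "card (pverts G - S)" arbitrary: S par c rule: less_induct)
    case less
    show ?case
    proof (cases "S = pverts G")
      case True
      then show ?thesis using less by blast
    next
      case False
      then obtain S' par' c' where S': "S \<subset> S'" "Inv S' par' c'"
        using step less by meson
      have "card (pverts G - S') < card (pverts G - S)"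
        using S' assms(2)[OF S'(2)] pair_finite_verts by (intro psubset_card_mono) auto
      then show ?thesis using less(1) S' by blast
    qed
  qed
  then show ?thesis using assms(1) that by blast
qed

section \<open>The case of a spare color or a root of small degree\<close>

text \<open>Automorphisms preserve degrees, so the root is recognisable once no other vertex of the
  same degree has its color. There is room for this if one more color is available, or if such
  vertices have fewer than \<open>max_deg\<close> neighbors.\<close>

lemma distinguishable_of_slack:
  assumes L: "lists_of_size k L" and r: "r \<in> pverts G" and k: "max_deg < k"
    and slack: "k = 2 * max_deg \<or> k = 2 * max_deg - 1 \<and> card (nbrs r) < max_deg"
  shows "properly_L_distinguishable G L"
proof -
  define Inv where "Inv S par c \<longleftrightarrow> tree_coloring L r S par c \<and>
    (\<forall>v\<in>S - {r}. card (nbrs v) = card (nbrs r) \<longrightarrow> c v \<noteq> c r)" for S par and c :: "'a \<Rightarrow> nat"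
  obtain par0 c0 where start: "tree_coloring L r (insert r (nbrs r)) par0 c0"
    "\<And>v. v \<in> nbrs r \<Longrightarrow> c0 v \<noteq> c0 r"
    using tree_coloring_start[OF r L k] by blast
  have init: "Inv (insert r (nbrs r)) par0 c0"
    using start unfolding Inv_def by auto
  have sub: "S \<subseteq> pverts G" if "Inv S par c" for S par c
    using that unfolding Inv_def tree_coloring_def search_tree_def by auto
  have step: "\<exists>S' par' c'. S \<subset> S' \<and> Inv S' par' c'" if I: "Inv S par c" and S: "S \<noteq> pverts G" for S par c
  proof -
    have tc: "tree_coloring L r S par c" using I unfolding Inv_def by auto
    then have st: "search_tree r S par" "nbrs r \<subseteq> S" "r \<in> S"
      unfolding tree_coloring_def search_tree_def by auto
    obtain p where p: "p \<in> S" "nbrs p - S \<noteq> {}"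
      using boundary_vertex[OF st(3)] sub[OF I] S by blast
    then obtain y where y: "y \<in> nbrs p - S" by blast
    define B where "B v = (if card (nbrs v) = card (nbrs r) then {c r} else {})" for v
    \<comment> \<open>The summands are at most \<open>max_deg - 1\<close>, the degree of
      \<open>v\<close>, and 1. In the case of \<open>2 * max_deg - 1\<close> colors the last one
      counts only if the degree of \<open>v\<close> is that of \<open>r\<close>, which is below
      \<open>max_deg\<close>.\<close>
    have bound: "card (nbrs p - S) + card (nbrs v \<inter> S) + card (B v) \<le> k" if "v \<in> nbrs p - S" for v
    proof -
      have "card (nbrs v \<inter> S) \<le> card (nbrs v)" by (simp add: card_mono)
      moreover have "card (nbrs v) \<le> max_deg" using that card_nbrs_le in_nbrsD by blast
      moreover have "card (nbrs p - S) \<le> max_deg - 1" using card_new_nbrs(3)[OF st(1,2) p] .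
      moreover have "card (B v) = (if card (nbrs v) = card (nbrs r) then 1 else 0)"
        by (simp add: B_def)
      ultimately show ?thesis using slack k by (auto split: if_splits)
    qed
    obtain c' where c': "tree_coloring L r (S \<union> nbrs p) (graft par S p) c'"
      "\<And>v. v \<in> S \<Longrightarrow> c' v = c v" "\<And>v. v \<in> nbrs p - S \<Longrightarrow> c' v \<notin> B v"
    proof (rule tree_coloring_extend[OF tc p(1) y L, of B])
      show "finite (B v)" for v by (simp add: B_def)
      show "card (nbrs p - S) + card (nbrs y \<inter> S) + card (B y) \<le> k"
        using bound[OF y] .
      show "card (nbrs p - S) + card (nbrs v \<inter> S) + card (B v) \<le> Suc k" if "v \<in> nbrs p - S - {y}" for v
        using bound[of v] that by auto
    qed blast
    have "Inv (S \<union> nbrs p) (graft par S p) c'"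
      unfolding Inv_def
    proof (intro conjI ballI impI)
      fix v assume v: "v \<in> S \<union> nbrs p - {r}" "card (nbrs v) = card (nbrs r)"
      show "c' v \<noteq> c' r"
      proof (cases "v \<in> S")
        case True
        then show ?thesis using I v c'(2) st(3) unfolding Inv_def by auto
      next
        case False
        then show ?thesis using c'(3)[of v] c'(2)[OF st(3)] v unfolding B_def by auto
      qed
    qed (rule c')
    moreover have "S \<subset> S \<union> nbrs p" using y by blast
    ultimately show ?thesis by blast
  qed
  obtain par c where c: "Inv (pverts G) par c"
    by (rule grow_to_all[of Inv, OF init sub step])
  show ?thesis
  proof (rule tree_coloring_distinguishable)
    show "tree_coloring L r (pverts G) par c" using c unfolding Inv_def by auto
    fix \<phi> assume \<phi>: "graph_automorphism G \<phi>" "\<forall>v\<in>pverts G. c (\<phi> v) = c v"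
    have "\<phi> r \<in> pverts G"
      using \<phi>(1) r unfolding graph_automorphism_def bij_betw_def by blast
    then show "\<phi> r = r"
      using c automorphism_card_nbrs[OF \<phi>(1) r] \<phi>(2) r unfolding Inv_def by blast
  qed
qed

subsection \<open>Regular graphs of degree at least three\<close>

text \<open>The only colored neighbor of \<open>p\<close> is its parent \<open>q\<close>. A new
  color must avoid those of \<open>q\<close>, \<open>r\<close> and \<open>p\<close> itself and of at
  most \<open>max_deg - 2\<close> siblings: at most \<open>max_deg + 1\<close> colors, fewer than
  \<open>2 * max_deg - 1\<close> since \<open>max_deg \<ge> 3\<close>.\<close>

lemma tree_coloring_recolor:
  assumes tc: "tree_coloring L r S par c" and L: "lists_of_size (2 * max_deg - 1) L" and D: "3 \<le> max_deg"
    and p: "p \<in> S" "p \<noteq> r" "p \<notin> nbrs r" and only: "nbrs p \<inter> S = {par p}"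
  obtains x where "x \<noteq> c p" "x \<noteq> c r" "tree_coloring L r S par (c(p := x))"
proof -
  define q where "q = par p"
  have st: "S \<subseteq> pverts G"
    "\<And>v. v \<in> S - {r} \<Longrightarrow> par v \<in> S \<and> par v \<in> nbrs v \<and> (par v \<noteq> r \<longrightarrow> par (par v) \<noteq> v)"
    using tc unfolding tree_coloring_def search_tree_def by auto
  have q: "q \<in> S" "q \<in> nbrs p" "p \<in> nbrs q" "q \<noteq> r"
    using st(2)[of p] p nbrs_sym[of p "par p"] nbrs_sym[of p r] unfolding q_def by auto
  define Sib where "Sib = {v \<in> S - {r}. par v = q} - {p}"
  \<comment> \<open>The clause \<open>par (par v) \<noteq> v\<close> of \<open>search_tree\<close>
    keeps \<open>par q\<close> out of the siblings and, further below, distinct from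
    \<open>p\<close>. So two neighbors of \<open>q\<close> are not in \<open>Sib\<close>.\<close>
  have sub: "Sib \<subseteq> nbrs q - {p, par q}"
  proof
    fix v assume v: "v \<in> Sib"
    then show "v \<in> nbrs q - {p, par q}"
      using st(2)[of v] q(4) nbrs_sym[of v q] unfolding Sib_def by auto
  qed
  have "par q \<noteq> p" "par q \<in> nbrs q"
    using st(2)[of p] st(2)[of q] p q unfolding q_def by auto
  then have two: "card {p, par q} = 2" "{p, par q} \<subseteq> nbrs q"
    using q by auto
  have "card (nbrs q) \<le> max_deg" using card_nbrs_le q st(1) by blast
  then have "card (nbrs q - {p, par q}) \<le> max_deg - 2"
    using two by (simp add: card_Diff_subset)
  then have Sib: "card Sib \<le> max_deg - 2" "finite Sib"
    using card_mono[OF _ sub] finite_subset[OF sub] by auto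
  have three: "card {c q, c r, c p} \<le> 3"
    by (simp add: card_insert_if)
  have Lp: "finite (L p)" "card (L p) = 2 * max_deg - 1"
    using L p st(1) unfolding lists_of_size_def by auto
  have "card Sib + card {c q, c r, c p} \<le> max_deg + 1"
    using Sib three D by linarith
  then have "card (L p) \<le> max_deg + 1 + card (L p - c ` Sib - {c q, c r, c p})"
    by (intro card_avoiding Sib(2) Lp(1)) simp
  then have "L p - c ` Sib - {c q, c r, c p} \<noteq> {}"
    using Lp D by (intro notI) simp
  then obtain x where x: "x \<in> L p" "x \<notin> c ` Sib" "x \<noteq> c q" "x \<noteq> c r" "x \<noteq> c p"
    by blast
  have "sibling_injective r S par (c(p := x))"
    unfolding sibling_injective_def
  proof (intro ballI impI)
    fix u v assume uv: "u \<in> S - {r}" "v \<in> S - {r}" "par u = par v \<and> (c(p := x)) u = (c(p := x)) v"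
    have "c w \<noteq> x" if "w \<in> S - {r}" "par w = par p" "w \<noteq> p" for w
      using that x(2) unfolding Sib_def q_def by blast
    moreover have "u = v" if "u \<noteq> p" "v \<noteq> p"
      using tc uv that unfolding tree_coloring_def sibling_injective_def by simp
    ultimately show "u = v"
      using uv by (cases "u = p"; cases "v = p") fastforce+
  qed
  moreover have "(c(p := x)) u \<noteq> (c(p := x)) v" if uv: "u \<in> S" "v \<in> S" "v \<in> nbrs u" for u v
  proof -
    have "u = q" if "u \<in> nbrs p" using that uv only q_def by auto
    moreover have "v = q" if "v \<in> nbrs p" using that uv only q_def by auto
    moreover have "c u \<noteq> c v" using tc uv unfolding tree_coloring_def by blast
    moreover have "u \<noteq> v" "u \<in> nbrs v" using uv nbrs_sym[of u v] by auto
    ultimately show ?thesis using uv x by auto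
  qed
  ultimately have "tree_coloring L r S par (c(p := x))"
    using tc x(1) unfolding tree_coloring_def by auto
  then show ?thesis using that x by blast
qed

text \<open>All outside vertices adjacent to \<open>S\<close> have the neighborhood of
  \<open>r\<close>; together with \<open>r\<close> they form one part \<open>W\<close>, and
  \<open>nbrs r\<close> is the other. A vertex of \<open>nbrs r\<close> is adjacent to some outside
  vertex, so by counting \<open>r\<close> is its only neighbor in \<open>S\<close> and its
  neighborhood is \<open>W\<close>. Connectivity leaves no other vertices.\<close>

lemma complete_bipartite_of_stuck:
  assumes reg: "\<And>v. v \<in> pverts G \<Longrightarrow> card (nbrs v) = max_deg"
    and r: "r \<in> S" "nbrs r \<subseteq> S" and S: "S \<subset> pverts G"
    and one: "\<And>p. p \<in> S \<Longrightarrow> nbrs p - S \<noteq> {} \<Longrightarrow> card (nbrs p - S) = max_deg - 1"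
    and same: "\<And>p y. p \<in> S \<Longrightarrow> y \<in> nbrs p - S \<Longrightarrow> nbrs y = nbrs r"
  shows "complete_bipartite_digraph max_deg max_deg (with_proj G)"
proof -
  define W where "W = insert r ((\<Union>p\<in>S. nbrs p) - S)"
  have Wn: "nbrs b = nbrs r" if "b \<in> W" for b
    using that same unfolding W_def by blast
  obtain p0 y0 where y0: "p0 \<in> S" "y0 \<in> nbrs p0 - S"
    using boundary_vertex[OF r(1) S] by blast
  have An: "nbrs p = W" if p: "p \<in> nbrs r" for p
  proof
    show "W \<subseteq> nbrs p" using Wn p nbrs_sym by blast
    have pS: "p \<in> S" "p \<in> pverts G" using p r S by auto
    have "y0 \<in> nbrs p" using same[OF y0] p nbrs_sym by blast
    then have "card (nbrs p - S) = max_deg - 1" using one[OF pS(1)] y0 by blast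
    moreover have "card (nbrs p) = max_deg" using reg pS by blast
    moreover have "card (nbrs p) = card (nbrs p - S) + card (nbrs p \<inter> S)"
      by (metis add.commute card_Int_Diff finite_nbrs)
    ultimately have "card (nbrs p \<inter> S) \<le> 1" by linarith
    moreover have "r \<in> nbrs p \<inter> S" using p r nbrs_sym by blast
    ultimately have "nbrs p \<inter> S = {r}"
      by (metis One_nat_def card_le_Suc0_iff_eq finite_Int finite_nbrs is_singletonI' is_singleton_the_elem singletonD empty_iff)
    then show "nbrs p \<subseteq> W" using pS unfolding W_def by blast
  qed
  have V: "nbrs r \<union> W = pverts G"
  proof (rule closed_under_nbrs)
    show "r \<in> nbrs r \<union> W" by (simp add: W_def)
    show "nbrs r \<union> W \<subseteq> pverts G" using nbrs_subset r S unfolding W_def by blast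
    show "nbrs v \<subseteq> nbrs r \<union> W" if "v \<in> nbrs r \<union> W" for v
      using that An Wn by blast
  qed
  have rV: "r \<in> pverts G" using r S by blast
  have "nbrs r \<inter> W = {}" using r unfolding W_def by auto
  moreover have "card (nbrs r) = max_deg" using reg rV by blast
  moreover have "card W = max_deg"
  proof -
    have "nbrs p0 \<noteq> {}" "p0 \<in> nbrs y0" using y0 nbrs_sym[of p0 y0] by auto
    then have "p0 \<in> nbrs r" using same[OF y0] by simp
    then show ?thesis using An[of p0] reg[of p0] in_nbrsD by simp
  qed
  moreover have "parcs G = nbrs r \<times> W \<union> W \<times> nbrs r"
  proof -
    have "(u, v) \<in> parcs G \<longleftrightarrow> (u \<in> nbrs r \<and> v \<in> W \<or> u \<in> W \<and> v \<in> nbrs r)" for u v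
    proof -
      have "(u, v) \<in> parcs G \<longleftrightarrow> v \<in> nbrs u" by (simp add: nbrs_def)
      moreover have "v \<in> nbrs u \<Longrightarrow> u \<in> nbrs r \<union> W" using V in_nbrsD by blast
      ultimately show ?thesis using An Wn by blast
    qed
    then show ?thesis by auto
  qed
  ultimately show ?thesis
    unfolding complete_bipartite_digraph_pair_def using V pair_finite_verts by metis
qed

text \<open>The root is recognised by its color together with the set of colors around it. Each
  expansion has one delicate vertex \<open>y\<close>: it avoids the root color if the count allows,
  and otherwise its neighborhood is made to look different, after a recoloring if necessary.\<close>

lemma distinguishable_of_regular:
  assumes L: "lists_of_size (2 * max_deg - 1) L" and D: "3 \<le> max_deg"
    and reg: "\<And>v. v \<in> pverts G \<Longrightarrow> card (nbrs v) = max_deg"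
    and not_bip: "\<not> complete_bipartite_digraph max_deg max_deg (with_proj G)"
  shows "properly_L_distinguishable G L"
proof -
  define k where "k = 2 * max_deg - 1"
  have k: "max_deg < k" "Suc k = 2 * max_deg" using D unfolding k_def by auto
  have Lk: "lists_of_size k L" using L by (simp add: k_def)
  obtain r where r: "r \<in> pverts G" using pverts_nonempty by blast
  \<comment> \<open>A vertex \<open>z\<close> reusing the root color has a completely colored
    neighborhood, so later expansions leave the colors around it alone. That it has no children
    protects those colors from recoloring, which only touches vertices whose one colored neighbor is
    their parent.\<close>
  define Inv where "Inv S par c \<longleftrightarrow> tree_coloring L r S par c \<and>
    (\<forall>z\<in>S - {r}. c z = c r \<longrightarrow> nbrs z \<subseteq> S \<and> z \<notin> par ` (S - {r}) \<and> c ` nbrs z \<noteq> c ` nbrs r) \<and>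
    inj_on c (nbrs r)"
    for S par and c :: "'a \<Rightarrow> nat"
  obtain par0 c0 where start: "tree_coloring L r (insert r (nbrs r)) par0 c0"
    "\<And>v. v \<in> nbrs r \<Longrightarrow> c0 v \<noteq> c0 r" "inj_on c0 (nbrs r)"
    using tree_coloring_start[OF r Lk k(1)] by blast
  have init: "Inv (insert r (nbrs r)) par0 c0"
    using start unfolding Inv_def by auto
  have sub: "S \<subseteq> pverts G" if "Inv S par c" for S par c
    using that unfolding Inv_def tree_coloring_def search_tree_def by auto
  \<comment> \<open>All new siblings other than \<open>y\<close> avoid the root color: this costs at
    most \<open>(max_deg - 1) + max_deg + 1 = Suc k\<close>, which is allowed for them. Only for
    \<open>y\<close> may the restriction have to be dropped, with \<open>B = {}\<close>.\<close>
  have extend: "\<exists>S' par' c'. S \<subset> S' \<and> Inv S' par' c'"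
    if I: "Inv S par c" and p: "p \<in> S" and y: "y \<in> nbrs p - S"
      and B: "B = {} \<and> nbrs y \<subseteq> S \<and> c ` nbrs y \<noteq> c ` nbrs r \<or> B = {c r}"
      and count: "card (nbrs p - S) + card (nbrs y \<inter> S) + card B \<le> k" for S par c p y B
  proof -
    have tc: "tree_coloring L r S par c" using I unfolding Inv_def by blast
    then have st: "search_tree r S par" "nbrs r \<subseteq> S" "r \<in> S"
      unfolding tree_coloring_def search_tree_def by auto
    have new: "card (nbrs p - S) \<le> max_deg - 1"
      using card_new_nbrs(3)[OF st(1,2) p] y by blast
    obtain c' where c': "tree_coloring L r (S \<union> nbrs p) (graft par S p) c'"
      "\<And>v. v \<in> S \<Longrightarrow> c' v = c v" "\<And>v. v \<in> nbrs p - S \<Longrightarrow> c' v \<notin> (if v = y then B else {c r})"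
    proof (rule tree_coloring_extend[OF tc p y Lk, of "\<lambda>v. if v = y then B else {c r}"])
      show "finite (if v = y then B else {c r})" for v using B by auto
      show "card (nbrs p - S) + card (nbrs y \<inter> S) + card (if y = y then B else {c r}) \<le> k"
        using count by simp
      show "card (nbrs p - S) + card (nbrs v \<inter> S) + card (if v = y then B else {c r}) \<le> Suc k"
        if v: "v \<in> nbrs p - S - {y}" for v
      proof -
        have "card (nbrs v \<inter> S) \<le> card (nbrs v)" by (simp add: card_mono)
        moreover have "card (nbrs v) = max_deg" using v reg in_nbrsD by blast
        ultimately show ?thesis using new k v by simp
      qed
    qed blast
    have im: "c' ` nbrs z = c ` nbrs z" if "nbrs z \<subseteq> S" for z
      using that c'(2) by (intro image_cong) auto
    have "Inv (S \<union> nbrs p) (graft par S p) c'"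
      unfolding Inv_def
    proof (intro conjI ballI impI)
      fix z assume z: "z \<in> S \<union> nbrs p - {r}" "c' z = c' r"
      have "nbrs z \<subseteq> S \<and> c ` nbrs z \<noteq> c ` nbrs r \<and> z \<notin> par ` (S - {r}) \<and> z \<noteq> p"
      proof (cases "z \<in> S")
        case True
        then have "c z = c r" using z c'(2) st(3) by simp
        then show ?thesis using I z True y unfolding Inv_def by blast
      next
        case False
        then have zD: "z \<in> nbrs p - S" using z by blast
        have "c' z = c r" using z c'(2) st(3) by simp
        then have "z = y" "B = {}" using c'(3)[OF zD] B by (auto split: if_splits)
        moreover have "z \<notin> par ` (S - {r})" using False st(1) unfolding search_tree_def by blast
        ultimately show ?thesis using B p False by auto
      qed
      then show "nbrs z \<subseteq> S \<union> nbrs p" "c' ` nbrs z \<noteq> c' ` nbrs r"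
        "z \<notin> graft par S p ` (S \<union> nbrs p - {r})"
        using im st(2) unfolding graft_def by auto
    next
      show "inj_on c' (nbrs r)"
        using I c'(2) st(2) inj_on_cong[of "nbrs r" c' c] unfolding Inv_def by blast
    qed (rule c')
    moreover have "S \<subset> S \<union> nbrs p" using y by blast
    ultimately show ?thesis by blast
  qed
  have step: "\<exists>S' par' c'. S \<subset> S' \<and> Inv S' par' c'" if I: "Inv S par c" and S: "S \<noteq> pverts G" for S par c
  proof -
    have tc: "tree_coloring L r S par c" using I unfolding Inv_def by blast
    then have st: "search_tree r S par" "nbrs r \<subseteq> S" "r \<in> S" "S \<subset> pverts G"
      using S unfolding tree_coloring_def search_tree_def by auto
    have cle: "card (nbrs y \<inter> S) \<le> max_deg" if "y \<in> pverts G" for y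
      using reg[OF that] card_mono[of "nbrs y" "nbrs y \<inter> S"] by simp
    show ?thesis
    \<comment> \<open>If \<open>p\<close> has few new neighbors, or \<open>y\<close> still has an
      uncolored neighbor, one color is saved and \<open>y\<close> can avoid the root color as
      well.\<close>
    proof (cases "\<exists>p\<in>S. \<exists>y\<in>nbrs p - S. card (nbrs p - S) \<le> max_deg - 2 \<or> \<not> nbrs y \<subseteq> S")
      case True
      then obtain p y where p: "p \<in> S" and y: "y \<in> nbrs p - S"
        and slack: "card (nbrs p - S) \<le> max_deg - 2 \<or> \<not> nbrs y \<subseteq> S" by blast
      have yV: "y \<in> pverts G" using y in_nbrsD by blast
      have new: "card (nbrs p - S) \<le> max_deg - 1"
        using card_new_nbrs(3)[OF st(1,2) p] y by blast
      have "card (nbrs p - S) + card (nbrs y \<inter> S) + card {c r} \<le> k"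
      proof (cases "nbrs y \<subseteq> S")
        case True
        then show ?thesis using slack cle[OF yV] k D by simp
      next
        case False
        then have "card (nbrs y \<inter> S) < card (nbrs y)" by (intro psubset_card_mono) auto
        then show ?thesis using reg[OF yV] new k by simp
      qed
      then show ?thesis using extend[OF I p y, of "{c r}"] by blast
    next
      case False
      then have full: "nbrs y \<subseteq> S" "card (nbrs p - S) = max_deg - 1" if "p \<in> S" "y \<in> nbrs p - S" for p y
        using that card_new_nbrs(3)[OF st(1,2), of p] by (blast, fastforce)
      have "\<exists>p\<in>S. \<exists>y\<in>nbrs p - S. nbrs y \<noteq> nbrs r"
      proof (rule ccontr)
        assume "\<not> ?thesis"
        then have "complete_bipartite_digraph max_deg max_deg (with_proj G)"
          using full(2) by (intro complete_bipartite_of_stuck[OF reg st(3,2,4)]) blast+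
        then show False using not_bip by blast
      qed
      then obtain p' y where y': "p' \<in> S" "y \<in> nbrs p' - S" "nbrs y \<noteq> nbrs r" by blast
      have yV: "y \<in> pverts G" using y' in_nbrsD by blast
      \<comment> \<open>The neighborhoods have equal size, so they are not nested. The vertex to
        expand becomes \<open>p\<close>, a neighbor of \<open>y\<close> but not of \<open>r\<close>:
        recoloring it affects the colors around \<open>y\<close> and leaves those around
        \<open>r\<close> unchanged.\<close>
      have "\<not> nbrs y \<subseteq> nbrs r"
        using y'(3) reg[OF yV] reg[OF r] by (metis card_subset_eq finite_nbrs)
      then obtain p where p: "p \<in> nbrs y" "p \<notin> nbrs r" by blast
      have pS: "p \<in> S" using p full(1)[OF y'(1,2)] by blast
      have y: "y \<in> nbrs p - S" using p y' nbrs_sym by blast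
      have pr: "p \<noteq> r" using y st(2) by blast
      have parp: "par p \<in> nbrs p \<inter> S" using st(1) pS pr unfolding search_tree_def by blast
      have "card (nbrs p) = card (nbrs p - S) + card (nbrs p \<inter> S)"
        by (metis add.commute card_Int_Diff finite_nbrs)
      then have "card (nbrs p \<inter> S) = 1"
        using full(2)[OF pS y] reg[of p] pS st(4) D by auto
      then have only: "nbrs p \<inter> S = {par p}"
        using parp by (metis card_1_singletonE singletonD)
      have count: "card (nbrs p - S) + card (nbrs y \<inter> S) + card {} \<le> k"
        using full(2)[OF pS y] cle[OF yV] k by simp
      show ?thesis
      proof (cases "c ` nbrs y = c ` nbrs r")
        case False
        then show ?thesis using extend[OF I pS y _ count] full(1)[OF pS y] by blast
      next
        case True
        obtain x where x: "x \<noteq> c p" "x \<noteq> c r" "tree_coloring L r S par (c(p := x))"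
          using tree_coloring_recolor[OF tc L D pS pr p(2) only] by blast
        \<comment> \<open>Equal color sets and equal degrees make the colors around \<open>y\<close>
          pairwise distinct. Recoloring \<open>p\<close> therefore removes its old color from around
          \<open>y\<close>, while that color still occurs around \<open>r\<close>.\<close>
        have "inj_on c (nbrs r)" using I unfolding Inv_def by blast
        then have "card (c ` nbrs y) = card (nbrs y)"
          using True reg[OF yV] reg[OF r] by (simp add: card_image)
        then have injy: "inj_on c (nbrs y)" by (simp add: eq_card_imp_inj_on)
        have im: "(c(p := x)) ` nbrs z = c ` nbrs z" if "p \<notin> nbrs z" for z
          using that by (intro image_cong) auto
        have "c p \<notin> (c(p := x)) ` nbrs y"
          using injy p(1) x(1) unfolding inj_on_def by auto
        moreover have "c p \<in> (c(p := x)) ` nbrs r"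
          unfolding im[OF p(2)] True[symmetric] using p(1) by (rule imageI)
        ultimately have ne: "(c(p := x)) ` nbrs y \<noteq> (c(p := x)) ` nbrs r"
          by metis
        have "Inv S par (c(p := x))"
          unfolding Inv_def
        proof (intro conjI ballI impI)
          fix z assume z: "z \<in> S - {r}" "(c(p := x)) z = (c(p := x)) r"
          then have "z \<noteq> p" "c z = c r" using x pr by (auto split: if_splits)
          then have zI: "nbrs z \<subseteq> S" "z \<notin> par ` (S - {r})" "c ` nbrs z \<noteq> c ` nbrs r"
            using I z unfolding Inv_def by auto
          \<comment> \<open>A colored neighbor of \<open>p\<close> is the parent of
            \<open>p\<close>, but \<open>z\<close> has no children.\<close>
          moreover have "p \<notin> nbrs z"
          proof
            assume "p \<in> nbrs z"
            then have "z \<in> nbrs p \<inter> S" using z nbrs_sym by blast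
            then have "z = par p" using only by blast
            then show False using zI(2) pS pr by blast
          qed
          ultimately show "nbrs z \<subseteq> S" "z \<notin> par ` (S - {r})"
            "(c(p := x)) ` nbrs z \<noteq> (c(p := x)) ` nbrs r"
            using im p(2) by auto
        next
          show "inj_on (c(p := x)) (nbrs r)"
            using I p(2) unfolding Inv_def inj_on_def by auto
        qed (rule x)
        then show ?thesis using extend[OF _ pS y _ count] full(1)[OF pS y] ne by blast
      qed
    qed
  qed
  obtain par c where c: "Inv (pverts G) par c"
    by (rule grow_to_all[of Inv, OF init sub step])
  show ?thesis
  proof (rule tree_coloring_distinguishable)
    show "tree_coloring L r (pverts G) par c" using c unfolding Inv_def by blast
    fix \<phi> assume \<phi>: "graph_automorphism G \<phi>" "\<forall>v\<in>pverts G. c (\<phi> v) = c v"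
    have "\<phi> r \<in> pverts G"
      using \<phi>(1) r unfolding graph_automorphism_def bij_betw_def by blast
    moreover have "c ` nbrs (\<phi> r) = c ` nbrs r"
      unfolding automorphism_image_nbrs[OF \<phi>(1) r, symmetric] image_image
      using \<phi>(2) nbrs_subset by (intro image_cong) auto
    ultimately show "\<phi> r = r"
      using c \<phi>(2) r unfolding Inv_def by blast
  qed
qed

subsection \<open>Cycles\<close>

lemma not_three_nbrs:
  assumes "card (nbrs u) = 2" "x \<in> nbrs u" "y \<in> nbrs u" "z \<in> nbrs u" "x \<noteq> y" "y \<noteq> z" "x \<noteq> z"
  shows False
proof -
  have "card {x, y, z} \<le> card (nbrs u)"
    using assms by (intro card_mono) auto
  then show False using assms by simp
qed

definition cycle_enum :: "nat \<Rightarrow> (nat \<Rightarrow> 'a) \<Rightarrow> bool" where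
  "cycle_enum n v \<longleftrightarrow> 3 \<le> n \<and> bij_betw v {..<n} (pverts G) \<and>
    (\<forall>i<n. \<forall>j<n. v j \<in> nbrs (v i) \<longleftrightarrow> j = Suc i mod n \<or> i = Suc j mod n)"

text \<open>Take a longest path starting with \<open>r, a\<close>. All neighbors of its last vertex
  lie on it, and the second one can only be \<open>r\<close>, since each inner vertex already has
  its two neighbors on the path. The resulting cycle is closed under neighbors. Start and direction
  are free, so that a chosen edge can be placed later.\<close>

lemma cycle_enum_exists:
  assumes reg: "\<And>v. v \<in> pverts G \<Longrightarrow> card (nbrs v) = 2" and a: "a \<in> nbrs r"
  obtains n v where "cycle_enum n v" "v 0 = r" "v 1 = a"
proof -
  define path where "path xs \<longleftrightarrow> distinct xs \<and> set xs \<subseteq> pverts G \<and>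
    (\<forall>i. Suc i < length xs \<longrightarrow> xs ! Suc i \<in> nbrs (xs ! i)) \<and> 2 \<le> length xs \<and> xs ! 0 = r \<and> xs ! 1 = a" for xs
  have "path [r, a]"
    using a in_nbrsD[OF a] unfolding path_def by auto
  moreover have "\<forall>xs. path xs \<longrightarrow> length xs < Suc (card (pverts G))"
    using pair_finite_verts unfolding path_def by (metis card_mono distinct_card less_Suc_eq_le)
  ultimately obtain xs where xs: "path xs" and maximal: "\<And>ys. path ys \<Longrightarrow> length ys \<le> length xs"
    using ex_has_greatest_nat[of path "[r, a]" length] by blast
  define n where "n = length xs"
  define v where "v i = xs ! i" for i
  have n2: "2 \<le> n" and v01: "v 0 = r" "v 1 = a"
    and inj: "\<And>i j. i < n \<Longrightarrow> j < n \<Longrightarrow> v i = v j \<longleftrightarrow> i = j"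
    and V: "\<And>i. i < n \<Longrightarrow> v i \<in> pverts G"
    and adj: "\<And>i. Suc i < n \<Longrightarrow> v (Suc i) \<in> nbrs (v i)"
    and set: "set xs = v ` {..<n}"
    using xs unfolding path_def n_def v_def by (auto simp: nth_eq_iff_index_eq set_conv_nth)
  define l where "l = v (n - 1)"
  have closed: "nbrs l \<subseteq> set xs"
  proof
    fix w assume w: "w \<in> nbrs l"
    show "w \<in> set xs"
    proof (rule ccontr)
      assume "w \<notin> set xs"
      moreover have "(xs @ [w]) ! Suc i \<in> nbrs ((xs @ [w]) ! i)" if "Suc i < length (xs @ [w])" for i
      proof (cases "Suc i < n")
        case True
        then show ?thesis using adj[of i] by (simp add: nth_append n_def v_def)
      next
        case False
        then have "i = n - 1" using that by (simp add: n_def)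
        moreover have "xs \<noteq> []" using n2 by (auto simp: n_def)
        ultimately show ?thesis using w by (simp add: nth_append n_def v_def l_def)
      qed
      ultimately have "path (xs @ [w])"
        using xs w in_nbrsD unfolding path_def by (auto simp: nth_append)
      then show False using maximal[of "xs @ [w]"] by simp
    qed
  qed
  have lV: "l \<in> pverts G" using V n2 unfolding l_def by simp
  have prev: "v (n - 2) \<in> nbrs l"
    using adj[of "n - 2"] n2 nbrs_sym[of "v (n - 2)" l] unfolding l_def
    by (simp add: numeral_2_eq_2 Suc_diff_Suc)
  have "\<exists>w \<in> nbrs l. w \<noteq> v (n - 2)"
  proof (rule ccontr)
    assume "\<not> ?thesis"
    then have "nbrs l \<subseteq> {v (n - 2)}" by blast
    then have "card (nbrs l) \<le> card {v (n - 2)}" by (intro card_mono) auto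
    then show False using reg[OF lV] by simp
  qed
  then obtain w where w: "w \<in> nbrs l" "w \<noteq> v (n - 2)" by blast
  then obtain j where j: "j < n" "w = v j" using closed set by auto
  have j0: "j = 0"
  proof (rule ccontr)
    assume "j \<noteq> 0"
    moreover have "j \<noteq> n - 1" using w j unfolding l_def by auto
    moreover have "j \<noteq> n - 2" using w j by auto
    ultimately have jb: "0 < j" "Suc j < n - 1" using j by auto
    have "v (j - 1) \<in> nbrs (v j)" using adj[of "j - 1"] jb nbrs_sym[of "v (j - 1)" "v j"] by simp
    moreover have "v (Suc j) \<in> nbrs (v j)" using adj[of j] jb by simp
    moreover have "v (n - 1) \<in> nbrs (v j)" using w j nbrs_sym[of l w] unfolding l_def by simp
    moreover have "v (j - 1) \<noteq> v (Suc j)" "v (Suc j) \<noteq> v (n - 1)" "v (j - 1) \<noteq> v (n - 1)"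
      using jb inj by auto
    ultimately show False using not_three_nbrs[OF reg[OF V[OF j(1)]]] by blast
  qed
  have n3: "3 \<le> n"
  proof (rule ccontr)
    assume "\<not> 3 \<le> n"
    then have "n - 2 = 0" using n2 by simp
    then show False using w j j0 by simp
  qed
  have succ: "v (Suc i mod n) \<in> nbrs (v i)" if "i < n" for i
  proof (cases "Suc i < n")
    case True
    then show ?thesis using adj by simp
  next
    case False
    then have "Suc i = n" using that by simp
    then show ?thesis using w j j0 unfolding l_def by auto
  qed
  define prd where "prd i = (if i = 0 then n - 1 else i - 1)" for i
  have prd: "prd i < n" "Suc (prd i) mod n = i" "prd i \<noteq> Suc i mod n" if "i < n" for i
    using that n3 unfolding prd_def by (auto simp: mod_Suc)
  have pred: "v (prd i) \<in> nbrs (v i)" if "i < n" for i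
    using succ[OF prd(1)[OF that]] prd(2)[OF that] nbrs_sym[of "v (prd i)" "v i"] by simp
  have nb: "w = v (Suc i mod n) \<or> w = v (prd i)" if "i < n" "w \<in> nbrs (v i)" for i w
  proof (rule ccontr)
    assume "\<not> ?thesis"
    moreover have "v (Suc i mod n) \<noteq> v (prd i)"
      using inj[of "Suc i mod n" "prd i"] prd[OF that(1)] n3 by auto
    ultimately show False
      using not_three_nbrs[OF reg[OF V[OF that(1)]] succ[OF that(1)] pred[OF that(1)] that(2)] by blast
  qed
  have all: "v ` {..<n} = pverts G"
  proof (rule closed_under_nbrs)
    show "v 0 \<in> v ` {..<n}" using n2 by simp
    show "v ` {..<n} \<subseteq> pverts G" using V by blast
    show "nbrs u \<subseteq> v ` {..<n}" if "u \<in> v ` {..<n}" for u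
    proof
      fix w assume "w \<in> nbrs u"
      with that obtain i where "i < n" "w = v (Suc i mod n) \<or> w = v (prd i)" using nb by blast
      then show "w \<in> v ` {..<n}" using prd(1)[of i] n3 by auto
    qed
  qed
  have "inj_on v {..<n}" using inj by (simp add: inj_on_def)
  then have bij: "bij_betw v {..<n} (pverts G)" using all unfolding bij_betw_def by simp
  have "v j \<in> nbrs (v i) \<longleftrightarrow> j = Suc i mod n \<or> i = Suc j mod n" if ij: "i < n" "j < n" for i j
  proof
    assume "v j \<in> nbrs (v i)"
    then have "j = Suc i mod n \<or> j = prd i"
      using nb[OF ij(1)] inj[OF ij(2)] prd(1)[OF ij(1)] n3 by (metis mod_less_divisor less_le_trans zero_less_numeral)
    then show "j = Suc i mod n \<or> i = Suc j mod n" using prd(2)[OF ij(1)] by auto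
  next
    assume "j = Suc i mod n \<or> i = Suc j mod n"
    then show "v j \<in> nbrs (v i)"
      using succ[OF ij(1)] succ[OF ij(2)] nbrs_sym[of "v i" "v j"] by auto
  qed
  then have "cycle_enum n v" using n3 bij unfolding cycle_enum_def by blast
  then show ?thesis using that v01 by blast
qed

lemma cycle_enum_eq_iff:
  "cycle_enum n v \<Longrightarrow> i < n \<Longrightarrow> j < n \<Longrightarrow> v i = v j \<longleftrightarrow> i = j"
  unfolding cycle_enum_def bij_betw_def by (auto dest: inj_onD)

lemma cycle_enum_in_pverts: "cycle_enum n v \<Longrightarrow> i < n \<Longrightarrow> v i \<in> pverts G"
  unfolding cycle_enum_def bij_betw_def by auto

lemma cycle_enum_obtain:
  assumes "cycle_enum n v" "w \<in> pverts G"
  obtains i where "i < n" "w = v i"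
  using assms unfolding cycle_enum_def bij_betw_def by blast

lemma cycle_enum_nbrs_iff:
  assumes "cycle_enum n v" "i < n" "j < n"
  shows "v j \<in> nbrs (v i) \<longleftrightarrow> j = Suc i \<or> i = Suc j \<or> i = 0 \<and> j = n - 1 \<or> j = 0 \<and> i = n - 1"
proof -
  have "v j \<in> nbrs (v i) \<longleftrightarrow> j = Suc i mod n \<or> i = Suc j mod n"
    using assms unfolding cycle_enum_def by blast
  then show ?thesis using assms(2,3) by (auto simp: mod_Suc split: if_splits)
qed

lemma cycle_enum_degree:
  assumes ce: "cycle_enum n v" and w: "w \<in> pverts G"
  shows "card (nbrs w) = 2"
proof -
  have n: "3 \<le> n" using ce unfolding cycle_enum_def by blast
  obtain i where i: "i < n" "w = v i" using cycle_enum_obtain[OF ce w] .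
  define s where "s = (if Suc i = n then 0 else Suc i)"
  define t where "t = (if i = 0 then n - 1 else i - 1)"
  have st: "s < n" "t < n" "s \<noteq> t" using i n unfolding s_def t_def by auto
  have "x \<in> nbrs w \<longleftrightarrow> x = v s \<or> x = v t" for x
  proof
    assume x: "x \<in> nbrs w"
    then obtain j where j: "j < n" "x = v j" using cycle_enum_obtain[OF ce] in_nbrsD by metis
    then have "j = s \<or> j = t"
      using cycle_enum_nbrs_iff[OF ce i(1) j(1)] x i unfolding s_def t_def by auto
    then show "x = v s \<or> x = v t" using j by auto
  next
    assume "x = v s \<or> x = v t"
    moreover have "v s \<in> nbrs (v i)" "v t \<in> nbrs (v i)"
      using cycle_enum_nbrs_iff[OF ce i(1)] st i unfolding s_def t_def by auto
    ultimately show "x \<in> nbrs w" using i by auto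
  qed
  then have "nbrs w = {v s, v t}" by blast
  then show ?thesis using cycle_enum_eq_iff[OF ce st(1,2)] st(3) by simp
qed

lemma cycle_enum_iso:
  assumes ce: "cycle_enum n v"
  shows "digraph_iso (with_proj G) (with_proj (cycle_graph n))"
proof -
  define h where "h = the_inv_into {..<n} v"
  have bij: "bij_betw v {..<n} (pverts G)" using ce unfolding cycle_enum_def by blast
  then have hbij: "bij_betw h (pverts G) {..<n}" unfolding h_def by (rule bij_betw_the_inv_into)
  have hv: "h (v i) = i" if "i < n" for i
    using that bij unfolding h_def bij_betw_def by (simp add: the_inv_into_f_f)
  define hom where "hom = \<lparr>iso_verts = h, iso_arcs = map_prod h h, iso_head = snd, iso_tail = fst :: nat \<times> nat \<Rightarrow> nat\<rparr>"
  have hinj: "inj_on h (pverts G)" "h ` pverts G = {..<n}" using hbij unfolding bij_betw_def by auto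
  have arcV: "parcs G \<subseteq> pverts G \<times> pverts G" using in_arcsD1 in_arcsD2 by auto
  have "pre_digraph.digraph_isomorphism (with_proj G) hom"
    unfolding pre_digraph.digraph_isomorphism_def
    using wf_digraph_axioms hinj(1) inj_on_subset[OF map_prod_inj_on[OF hinj(1) hinj(1)] arcV]
    by (auto simp: hom_def)
  moreover have "with_proj (cycle_graph n) = app_iso hom (with_proj G)"
  proof -
    have "(i, j) \<in> map_prod h h ` parcs G \<longleftrightarrow> i < n \<and> j < n \<and> (j = Suc i mod n \<or> i = Suc j mod n)" for i j
    proof -
      have "(i, j) \<in> map_prod h h ` parcs G \<longleftrightarrow> i < n \<and> j < n \<and> (v i, v j) \<in> parcs G"
      proof
        assume "(i, j) \<in> map_prod h h ` parcs G"
        then obtain x y where xy: "(x, y) \<in> parcs G" "i = h x" "j = h y" by auto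
        then obtain i' j' where "i' < n" "x = v i'" "j' < n" "y = v j'"
          using cycle_enum_obtain[OF ce] in_arcsD1 in_arcsD2 by metis
        then show "i < n \<and> j < n \<and> (v i, v j) \<in> parcs G" using xy hv by simp
      next
        assume ij: "i < n \<and> j < n \<and> (v i, v j) \<in> parcs G"
        then have "map_prod h h (v i, v j) = (i, j)" using hv by simp
        then show "(i, j) \<in> map_prod h h ` parcs G" using ij by (metis imageI)
      qed
      then show ?thesis using ce unfolding cycle_enum_def nbrs_def by blast
    qed
    then have "map_prod h h ` parcs G = parcs (cycle_graph n)"
      unfolding cycle_graph_def by auto
    then show ?thesis
      using hinj(2) unfolding app_iso_def hom_def with_proj_def by (simp add: cycle_graph_def)
  qed
  ultimately show ?thesis unfolding digraph_iso_def by blast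
qed

lemma iso_cycle_enum:
  assumes iso: "digraph_iso (with_proj G) (with_proj (cycle_graph n))" and n: "3 \<le> n"
  obtains v where "cycle_enum n v"
proof -
  obtain hom where hom: "pre_digraph.digraph_isomorphism (with_proj G) hom"
    and eq: "with_proj (cycle_graph n) = app_iso hom (with_proj G)"
    using iso unfolding digraph_iso_def by blast
  define h where "h = iso_verts hom"
  have im: "h ` pverts G = {..<n}"
    using arg_cong[OF eq, of verts] by (simp add: h_def cycle_graph_def)
  have arcs: "iso_arcs hom ` parcs G = parcs (cycle_graph n)"
    using arg_cong[OF eq, of arcs] by simp
  \<comment> \<open>Equality of the digraph records forces these projections, so
    \<open>iso_arcs hom\<close> is determined on arcs by the vertex map \<open>h\<close>.\<close>
  have proj: "iso_tail hom = fst" "iso_head hom = snd"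
    using arg_cong[OF eq, of tail] arg_cong[OF eq, of head] by simp_all
  have inj: "inj_on h (pverts G)"
    and ends: "\<And>e. e \<in> parcs G \<Longrightarrow> iso_arcs hom e = (h (fst e), h (snd e))"
    using hom proj unfolding pre_digraph.digraph_isomorphism_def h_def by (auto simp: prod_eq_iff)
  define v where "v = the_inv_into (pverts G) h"
  have bij: "bij_betw h (pverts G) {..<n}" using inj im unfolding bij_betw_def by simp
  then have vbij: "bij_betw v {..<n} (pverts G)" unfolding v_def by (rule bij_betw_the_inv_into)
  have hv: "h (v i) = i" "v i \<in> pverts G" if "i < n" for i
    using that inj im vbij unfolding v_def by (auto simp: f_the_inv_into_f bij_betw_def)
  have "v j \<in> nbrs (v i) \<longleftrightarrow> j = Suc i mod n \<or> i = Suc j mod n" if ij: "i < n" "j < n" for i j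
  proof -
    have "(v i, v j) \<in> parcs G \<longleftrightarrow> (i, j) \<in> parcs (cycle_graph n)"
    proof
      assume e: "(v i, v j) \<in> parcs G"
      then have "iso_arcs hom (v i, v j) \<in> parcs (cycle_graph n)"
        unfolding arcs[symmetric] by (rule imageI)
      moreover have "iso_arcs hom (v i, v j) = (i, j)"
        using ends[OF e] hv(1)[OF ij(1)] hv(1)[OF ij(2)] by simp
      ultimately show "(i, j) \<in> parcs (cycle_graph n)" by simp
    next
      assume "(i, j) \<in> parcs (cycle_graph n)"
      then obtain x y where xy: "(x, y) \<in> parcs G" "(i, j) = (h x, h y)"
        using arcs ends by fastforce
      then have "x \<in> pverts G" "y \<in> pverts G" using in_arcsD1 in_arcsD2 by auto
      then have "x = v i" "y = v j"
        using xy inj unfolding v_def by (simp_all add: the_inv_into_f_f)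
      then show "(v i, v j) \<in> parcs G" using xy by simp
    qed
    then show ?thesis using ij unfolding nbrs_def cycle_graph_def by simp
  qed
  then have "cycle_enum n v" using n vbij unfolding cycle_enum_def by blast
  then show ?thesis using that by blast
qed

text \<open>Even and odd positions are the two parts. This places length 4 among the exceptions, so
  the uniform coloring can exclude it.\<close>

lemma cycle_enum_4_complete_bipartite:
  assumes ce: "cycle_enum 4 v"
  shows "complete_bipartite_digraph 2 2 (with_proj G)"
proof -
  have all: "pverts G = {v 0, v 2} \<union> {v 1, v 3}"
  proof -
    have "{..<4::nat} = {0, 1, 2, 3}" by auto
    then show ?thesis using ce unfolding cycle_enum_def bij_betw_def by auto
  qed
  have ne: "v 0 \<noteq> v 1" "v 0 \<noteq> v 2" "v 0 \<noteq> v 3" "v 1 \<noteq> v 2" "v 1 \<noteq> v 3" "v 2 \<noteq> v 3"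
    using cycle_enum_eq_iff[OF ce] by auto
  have arc: "(v i, v j) \<in> parcs G \<longleftrightarrow> even i \<noteq> even j" if "i < 4" "j < 4" for i j
  proof -
    have "i = 0 \<or> i = 1 \<or> i = 2 \<or> i = 3" "j = 0 \<or> j = 1 \<or> j = 2 \<or> j = 3"
      using that by linarith+
    moreover have "(v i, v j) \<in> parcs G \<longleftrightarrow> j = Suc i \<or> i = Suc j \<or> i = 0 \<and> j = 3 \<or> j = 0 \<and> i = 3"
      using cycle_enum_nbrs_iff[OF ce that] unfolding nbrs_def by simp
    ultimately show ?thesis by (elim disjE) simp_all
  qed
  have "parcs G = {v 0, v 2} \<times> {v 1, v 3} \<union> {v 1, v 3} \<times> {v 0, v 2}"
  proof
    show "parcs G \<subseteq> {v 0, v 2} \<times> {v 1, v 3} \<union> {v 1, v 3} \<times> {v 0, v 2}"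
    proof
      fix e assume e: "e \<in> parcs G"
      obtain u w where uw: "e = (u, w)" by fastforce
      have "u \<in> {v 0, v 2} \<union> {v 1, v 3}" "w \<in> {v 0, v 2} \<union> {v 1, v 3}"
        using in_arcsD1 in_arcsD2 e unfolding uw all by blast+
      then show "e \<in> {v 0, v 2} \<times> {v 1, v 3} \<union> {v 1, v 3} \<times> {v 0, v 2}"
        using e arc unfolding uw by fastforce
    qed
    show "{v 0, v 2} \<times> {v 1, v 3} \<union> {v 1, v 3} \<times> {v 0, v 2} \<subseteq> parcs G"
      using arc by auto
  qed
  moreover have "card {v 0, v 2} = 2" "card {v 1, v 3} = 2" "{v 0, v 2} \<inter> {v 1, v 3} = {}"
    using ne by auto
  ultimately show ?thesis
    unfolding complete_bipartite_digraph_pair_def using all pair_finite_verts by metis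
qed

text \<open>Two consecutive fixed vertices force the next one to be fixed, because the other
  neighbor of the second is already taken as an image.\<close>

lemma cycle_enum_fixed:
  assumes ce: "cycle_enum n v" and \<phi>: "graph_automorphism G \<phi>"
    and fixed: "\<phi> (v 0) = v 0" "\<phi> (v 1) = v 1" and w: "w \<in> pverts G"
  shows "\<phi> w = w"
proof -
  have n: "3 \<le> n" using ce unfolding cycle_enum_def by blast
  have "Suc i < n \<Longrightarrow> \<phi> (v i) = v i \<and> \<phi> (v (Suc i)) = v (Suc i)" for i
  proof (induction i)
    case 0
    then show ?case using fixed by simp
  next
    case (Suc i)
    then have i: "i < n" "Suc i < n" "Suc (Suc i) < n" and
      IH: "\<phi> (v i) = v i" "\<phi> (v (Suc i)) = v (Suc i)" by auto
    have V: "v i \<in> pverts G" "v (Suc i) \<in> pverts G" "v (Suc (Suc i)) \<in> pverts G"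
      using i cycle_enum_in_pverts[OF ce] by auto
    have "v (Suc (Suc i)) \<in> nbrs (v (Suc i))"
      using cycle_enum_nbrs_iff[OF ce i(2,3)] by simp
    then have im: "\<phi> (v (Suc (Suc i))) \<in> nbrs (v (Suc i))"
      using automorphism_image_nbrs[OF \<phi> V(2)] IH(2) by auto
    then obtain j where j: "j < n" "\<phi> (v (Suc (Suc i))) = v j"
      using cycle_enum_obtain[OF ce] in_nbrsD(1) by metis
    have "j = Suc (Suc i) \<or> j = i"
      using im j cycle_enum_nbrs_iff[OF ce i(2) j(1)] i by auto
    moreover have "j \<noteq> i"
    proof
      assume "j = i"
      then have "v (Suc (Suc i)) = v i"
        using automorphism_inj[OF \<phi> V(3,1)] j IH by simp
      then show False using cycle_enum_eq_iff[OF ce i(3,1)] by simp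
    qed
    ultimately show ?case using IH j by auto
  qed
  note main = this
  obtain i where i: "i < n" "w = v i" using cycle_enum_obtain[OF ce w] .
  show ?thesis
  proof (cases i)
    case 0
    then show ?thesis using i fixed by simp
  next
    case (Suc j)
    then show ?thesis using i main[of j] by simp
  qed
qed

section \<open>Distinguishing colorings of cycles\<close>

text \<open>Once \<open>v 0\<close> is fixed, \<open>sep\<close> prevents its two neighbors from
  being exchanged, so \<open>v 1\<close> is fixed and with it the whole cycle.\<close>

lemma cycle_distinguishable:
  assumes ce: "cycle_enum n v" and inL: "\<And>i. i < n \<Longrightarrow> g i \<in> L (v i)"
    and proper: "\<And>i. Suc i < n \<Longrightarrow> g i \<noteq> g (Suc i)" "g (n - 1) \<noteq> g 0" and sep: "g 1 \<noteq> g (n - 1)"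
    and root: "\<And>\<phi>. graph_automorphism G \<phi> \<Longrightarrow>
      (\<And>i j. i < n \<Longrightarrow> j < n \<Longrightarrow> \<phi> (v i) = v j \<Longrightarrow> g i = g j) \<Longrightarrow> \<phi> (v 0) = v 0"
  shows "properly_L_distinguishable G L"
proof -
  have n: "3 \<le> n" and bij: "bij_betw v {..<n} (pverts G)" using ce unfolding cycle_enum_def by auto
  define c where "c = g \<circ> the_inv_into {..<n} v"
  have c: "c (v i) = g i" if "i < n" for i
    using that bij unfolding c_def bij_betw_def by (simp add: the_inv_into_f_f)
  have "proper_coloring G c"
    unfolding proper_coloring_def
  proof (intro ballI, clarify)
    fix u w assume e: "(u, w) \<in> parcs G" "c u = c w"
    then have "u \<in> pverts G" "w \<in> pverts G" using in_arcsD1 in_arcsD2 by auto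
    then obtain i j where ij: "i < n" "u = v i" "j < n" "w = v j"
      using cycle_enum_obtain[OF ce] by metis
    have "v j \<in> nbrs (v i)" using e ij by (simp add: nbrs_def)
    then have "j = Suc i \<or> i = Suc j \<or> i = 0 \<and> j = n - 1 \<or> j = 0 \<and> i = n - 1"
      using cycle_enum_nbrs_iff[OF ce ij(1,3)] by simp
    then have "g i \<noteq> g j" using proper ij by metis
    then show False using e ij c by simp
  qed
  moreover have "\<forall>w\<in>pverts G. c w \<in> L w"
    using inL c cycle_enum_obtain[OF ce] by metis
  moreover have "distinguishing G c"
    unfolding distinguishing_def
  proof (intro allI impI ballI)
    fix \<phi> w assume \<phi>c: "graph_automorphism G \<phi> \<and> (\<forall>v\<in>pverts G. c (\<phi> v) = c v)" and w: "w \<in> pverts G"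
    then have \<phi>: "graph_automorphism G \<phi>" by blast
    have pres: "g i = g j" if "i < n" "j < n" "\<phi> (v i) = v j" for i j
      using \<phi>c that c cycle_enum_in_pverts[OF ce] by metis
    have v0: "\<phi> (v 0) = v 0" using root[OF \<phi>] pres by blast
    have V0: "v 0 \<in> pverts G" using cycle_enum_in_pverts[OF ce] n by simp
    have "v 1 \<in> nbrs (v 0)" using cycle_enum_nbrs_iff[OF ce, of 0 1] n by simp
    then have im: "\<phi> (v 1) \<in> nbrs (v 0)" using automorphism_image_nbrs[OF \<phi> V0] v0 by auto
    then obtain j where j: "j < n" "\<phi> (v 1) = v j"
      using cycle_enum_obtain[OF ce] in_nbrsD(1) by metis
    then have "j = 1 \<or> j = n - 1" using im cycle_enum_nbrs_iff[OF ce, of 0 j] n by auto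
    moreover have "g 1 = g j" using pres[of 1 j] j n by simp
    ultimately have "\<phi> (v 1) = v 1" using sep j by auto
    then show "\<phi> w = w" using cycle_enum_fixed[OF ce \<phi> v0 _ w] by blast
  qed
  ultimately show ?thesis unfolding properly_L_distinguishable_def by blast
qed

lemma cycle_distinguishable_unique:
  assumes ce: "cycle_enum n v" and inL: "\<And>i. i < n \<Longrightarrow> g i \<in> L (v i)"
    and proper: "\<And>i. Suc i < n \<Longrightarrow> g i \<noteq> g (Suc i)" and sep: "g 1 \<noteq> g (n - 1)"
    and unique: "\<And>i. 0 < i \<Longrightarrow> i < n \<Longrightarrow> g i \<noteq> g 0"
  shows "properly_L_distinguishable G L"
proof (rule cycle_distinguishable[OF ce inL proper _ sep])
  have n: "3 \<le> n" using ce unfolding cycle_enum_def by blast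
  show "g (n - 1) \<noteq> g 0" using unique[of "n - 1"] n by simp
  fix \<phi> assume \<phi>: "graph_automorphism G \<phi>"
    and pres: "\<And>i j. i < n \<Longrightarrow> j < n \<Longrightarrow> \<phi> (v i) = v j \<Longrightarrow> g i = g j"
  have "v 0 \<in> pverts G" using cycle_enum_in_pverts[OF ce] n by simp
  then have "\<phi> (v 0) \<in> pverts G" using \<phi> unfolding graph_automorphism_def bij_betw_def by blast
  then obtain j where j: "j < n" "\<phi> (v 0) = v j" using cycle_enum_obtain[OF ce] by metis
  then have "g 0 = g j" using pres[of 0 j] n by simp
  then have "j = 0" using unique[of j] j by (cases "j = 0") auto
  then show "\<phi> (v 0) = v 0" using j by simp
qed

text \<open>For odd length the color \<open>a\<close> is unique to \<open>v 0\<close>. For even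
  length at least 8 it occurs at positions 0 and 3, and the colors seen when walking away from them
  tell the two apart.\<close>

lemma cycle_distinguishable_uniform:
  assumes ce: "cycle_enum n v" and n: "n \<noteq> 4" "n \<noteq> 6"
    and L: "\<And>i. i < n \<Longrightarrow> {a, b, c} \<subseteq> L (v i)" and abc: "a \<noteq> b" "b \<noteq> c" "a \<noteq> c"
  shows "properly_L_distinguishable G L"
proof (cases "odd n")
  case True
  have n3: "3 \<le> n" using ce unfolding cycle_enum_def by blast
  define g where "g i = (if i = 0 then a else if odd i then b else c)" for i :: nat
  show ?thesis
  proof (rule cycle_distinguishable_unique[OF ce])
    show "g i \<in> L (v i)" if "i < n" for i using L[OF that] unfolding g_def by auto
    show "g i \<noteq> g (Suc i)" for i using abc unfolding g_def by auto
    show "g 1 \<noteq> g (n - 1)" using True n3 abc unfolding g_def by auto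
    show "g i \<noteq> g 0" if "0 < i" for i using that abc unfolding g_def by auto
  qed
next
  case False
  have "3 \<le> n" using ce unfolding cycle_enum_def by blast
  then have n8: "8 \<le> n" using False n by presburger
  define g where "g i = (if i = 0 \<or> i = 3 then a else if i = 1 then b else if i = 2 then c
    else if even i then b else c)" for i :: nat
  show ?thesis
  proof (rule cycle_distinguishable[OF ce])
    show "g i \<in> L (v i)" if "i < n" for i using L[OF that] unfolding g_def by auto
    show "g i \<noteq> g (Suc i)" for i
    proof -
      have "i = 0 \<or> i = 1 \<or> i = 2 \<or> i = 3 \<or> 4 \<le> i" by linarith
      then show ?thesis using abc unfolding g_def by (elim disjE) auto
    qed
    have last: "g (n - 1) = c" using False n8 unfolding g_def by auto
    then show "g (n - 1) \<noteq> g 0" "g 1 \<noteq> g (n - 1)" using abc unfolding g_def by auto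
    fix \<phi> assume \<phi>: "graph_automorphism G \<phi>"
      and pres: "\<And>i j. i < n \<Longrightarrow> j < n \<Longrightarrow> \<phi> (v i) = v j \<Longrightarrow> g i = g j"
    have obt: "\<exists>j<n. \<phi> (v i) = v j \<and> g i = g j" if "i < n" for i
    proof -
      have "\<phi> (v i) \<in> pverts G"
        using \<phi> cycle_enum_in_pverts[OF ce that] unfolding graph_automorphism_def bij_betw_def by blast
      then show ?thesis using cycle_enum_obtain[OF ce] pres[OF that] by metis
    qed
    have next_img: "\<exists>j<n. \<phi> (v (Suc i)) = v j \<and> g (Suc i) = g j \<and>
        (j = Suc m \<or> m = Suc j \<or> m = 0 \<and> j = n - 1 \<or> j = 0 \<and> m = n - 1)"
      if i: "Suc i < n" "m < n" "\<phi> (v i) = v m" for i m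
    proof -
      obtain j where j: "j < n" "\<phi> (v (Suc i)) = v j" "g (Suc i) = g j" using obt[OF i(1)] by blast
      have "v (Suc i) \<in> nbrs (v i)" using cycle_enum_nbrs_iff[OF ce, of i "Suc i"] i by simp
      then have "\<phi> (v (Suc i)) \<in> \<phi> ` nbrs (v i)" by (rule imageI)
      then have "v j \<in> nbrs (v m)"
        using automorphism_image_nbrs[OF \<phi> cycle_enum_in_pverts[OF ce, of i]] i j by simp
      then show ?thesis using cycle_enum_nbrs_iff[OF ce i(2) j(1)] j by blast
    qed
    have zero: "j = 0 \<or> j = 3" if "g j = a" for j
      using that abc unfolding g_def by (auto split: if_splits)
    obtain j0 where j0: "j0 < n" "\<phi> (v 0) = v j0" "g 0 = g j0" using obt[of 0] n8 by auto
    \<comment> \<open>The walk 0, 1, 2, 3 with colors \<open>a\<close>, \<open>b\<close>,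
      \<open>c\<close>, \<open>a\<close> would be sent to 3, 4, 5 and then to 4 or 6. Both of these
      have color \<open>b\<close>; length at least 8 keeps position 6 distinct from 0.\<close>
    moreover have "j0 \<noteq> 3"
    proof
      assume 3: "j0 = 3"
      obtain j1 where j1: "j1 < n" "\<phi> (v 1) = v j1" "g 1 = g j1" "j1 = 4 \<or> j1 = 2"
        using next_img[of 0 3] n8 j0 3 by auto
      then have j1': "j1 = 4" using abc unfolding g_def by auto
      obtain j2 where j2: "j2 < n" "\<phi> (v 2) = v j2" "g 2 = g j2" "j2 = 5 \<or> j2 = 3"
        using next_img[of 1 4] n8 j1 j1' by (auto simp: numeral_2_eq_2)
      then have j2': "j2 = 5" using abc unfolding g_def by auto
      obtain j3 where j3: "j3 < n" "g 3 = g j3" "j3 = 6 \<or> j3 = 4"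
        using next_img[of 2 5] n8 j2 j2' by (auto simp: numeral_3_eq_3)
      then show False using abc unfolding g_def by auto
    qed
    ultimately show "\<phi> (v 0) = v 0" using zero[of j0] unfolding g_def by auto
  qed
qed

text \<open>A color \<open>x\<close> of \<open>L r\<close> outside \<open>L a\<close> is kept unique
  to \<open>r\<close>. The cycle is enumerated from \<open>r\<close> so that \<open>a\<close> comes
  last: each earlier vertex spends two exclusions on \<open>x\<close> and its predecessor, while
  \<open>a\<close> avoids \<open>x\<close> for free and can differ from both its predecessor and the
  vertex after \<open>r\<close>.\<close>

lemma cycle_distinguishable_nonuniform:
  assumes L: "lists_of_size 3 L" and reg: "\<And>v. v \<in> pverts G \<Longrightarrow> card (nbrs v) = 2"
    and a: "a \<in> nbrs r" and ne: "L r \<noteq> L a"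
  shows "properly_L_distinguishable G L"
proof -
  have V: "r \<in> pverts G" "a \<in> pverts G" using in_nbrsD[OF a] by auto
  have fin: "finite (L w)" "card (L w) = 3" if "w \<in> pverts G" for w
    using L that unfolding lists_of_size_def by auto
  have "\<not> L r \<subseteq> L a"
    using card_subset_eq[of "L a" "L r"] fin V ne by auto
  then obtain x where x: "x \<in> L r" "x \<notin> L a" by blast
  have "\<exists>b. b \<in> nbrs r \<and> b \<noteq> a"
  proof (rule ccontr)
    assume "\<not> ?thesis"
    then have "nbrs r \<subseteq> {a}" by blast
    then have "card (nbrs r) \<le> card {a}" by (intro card_mono) auto
    then show False using reg[OF V(1)] by simp
  qed
  then obtain b where b: "b \<in> nbrs r" "b \<noteq> a" by blast
  obtain n v where ce: "cycle_enum n v" and v: "v 0 = r" "v 1 = b"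
    using cycle_enum_exists[OF reg b(1)] by blast
  have n: "3 \<le> n" using ce unfolding cycle_enum_def by blast
  obtain m where m: "m < n" "a = v m" using cycle_enum_obtain[OF ce V(2)] .
  have last: "a = v (n - 1)"
    using a m v b cycle_enum_nbrs_iff[OF ce, of 0 m] n by auto
  have avail: "\<exists>y. y \<in> L w - {s, t}" if "w \<in> pverts G" for w s t
  proof (rule ccontr)
    assume "\<not> ?thesis"
    then have "L w \<subseteq> {s, t}" by blast
    then have "card (L w) \<le> card {s, t}" by (intro card_mono) auto
    moreover have "card {s, t} \<le> 2" by (simp add: card_insert_if)
    ultimately show False using fin[OF that] by simp
  qed
  \<comment> \<open>Greedy coloring along the cycle; the value at position \<open>n - 1\<close> is
    replaced by \<open>z\<close> below.\<close>
  define h where "h = rec_nat x (\<lambda>i z. SOME y. y \<in> L (v (Suc i)) - {z, x})"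
  have h0: "h 0 = x" by (simp add: h_def)
  have hS: "h (Suc i) \<in> L (v (Suc i)) - {h i, x}" if "Suc i < n" for i
  proof -
    have "h (Suc i) = (SOME y. y \<in> L (v (Suc i)) - {h i, x})" by (simp add: h_def)
    then show ?thesis
      using someI_ex[OF avail[OF cycle_enum_in_pverts[OF ce that], of "h i" x]] by simp
  qed
  obtain z where z: "z \<in> L a" "z \<noteq> h (n - 2)" "z \<noteq> h 1" using avail[OF V(2)] by blast
  have zx: "z \<noteq> x" using z x by blast
  define g where "g = h(n - 1 := z)"
  show ?thesis
  proof (rule cycle_distinguishable_unique[OF ce])
    show "g i \<in> L (v i)" if "i < n" for i
    proof (cases i)
      case 0
      then show ?thesis using h0 x v n by (simp add: g_def)
    next
      case (Suc j)
      then show ?thesis using hS[of j] that z last by (auto simp: g_def)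
    qed
    show "g i \<noteq> g (Suc i)" if "Suc i < n" for i
    proof (cases "Suc i = n - 1")
      case True
      then have "i = n - 2" by simp
      then show ?thesis using True z n by (auto simp: g_def)
    next
      case False
      then show ?thesis using hS[OF that] that by (auto simp: g_def)
    qed
    show "g 1 \<noteq> g (n - 1)" using z n by (auto simp: g_def)
    show "g i \<noteq> g 0" if i: "0 < i" "i < n" for i
    proof -
      obtain j where j: "i = Suc j" using i by (cases i) auto
      then show ?thesis using hS[of j] i zx h0 n by (auto simp: g_def)
    qed
  qed
qed

lemma distinguishable_of_2_regular:
  assumes L: "lists_of_size 3 L" and reg: "\<And>v. v \<in> pverts G \<Longrightarrow> card (nbrs v) = 2"
    and not_bip: "\<not> complete_bipartite_digraph 2 2 (with_proj G)"
    and not_C6: "\<not> digraph_iso (with_proj G) (with_proj (cycle_graph 6))"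
  shows "properly_L_distinguishable G L"
proof (cases "\<exists>r\<in>pverts G. \<exists>a\<in>nbrs r. L r \<noteq> L a")
  case True
  then show ?thesis using cycle_distinguishable_nonuniform[OF L reg] by blast
next
  case False
  obtain r where r: "r \<in> pverts G" using pverts_nonempty by blast
  have "{w \<in> pverts G. L w = L r} = pverts G"
  proof (rule closed_under_nbrs)
    show "nbrs u \<subseteq> {w \<in> pverts G. L w = L r}" if "u \<in> {w \<in> pverts G. L w = L r}" for u
      using that False in_nbrsD(1) by fastforce
  qed (use r in auto)
  then have same: "L w = L r" if "w \<in> pverts G" for w using that by blast
  have "card (L r) = 3" using L r unfolding lists_of_size_def by blast
  then obtain x y z where xyz: "L r = {x, y, z}" "x \<noteq> y" "y \<noteq> z" "x \<noteq> z"
    unfolding card_3_iff by metis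
  have "nbrs r \<noteq> {}" using reg[OF r] by auto
  then obtain a where a: "a \<in> nbrs r" by blast
  obtain n v where ce: "cycle_enum n v" using cycle_enum_exists[OF reg a] by blast
  have "n \<noteq> 4" "n \<noteq> 6"
    using ce cycle_enum_4_complete_bipartite cycle_enum_iso not_bip not_C6 by auto
  moreover have "{x, y, z} \<subseteq> L (v i)" if "i < n" for i
    using same[OF cycle_enum_in_pverts[OF ce that]] xyz(1) by simp
  ultimately show ?thesis
    by (intro cycle_distinguishable_uniform[OF ce _ _ _ xyz(2-4)])
qed

subsection \<open>Lower bounds\<close>

lemma list_dist_chromatic_number_lists:
  "list_dist_chromatic_number G = (LEAST k. \<forall>L. lists_of_size k L \<longrightarrow> properly_L_distinguishable G L)"
  unfolding list_dist_chromatic_number_def lists_of_size_def ..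

text \<open>Exchanging two vertices with the same neighborhood is an automorphism, and it preserves
  colors if theirs agree.\<close>

lemma twins_distinguished:
  assumes f: "distinguishing G f" and uw: "u \<in> pverts G" "w \<in> pverts G" "nbrs u = nbrs w" "f u = f w"
  shows "u = w"
proof -
  define \<phi> where "\<phi> x = (if x = u then w else if x = w then u else x)" for x
  have inv: "\<phi> (\<phi> x) = x" for x by (simp add: \<phi>_def)
  have V: "\<phi> x \<in> pverts G" if "x \<in> pverts G" for x using that uw by (simp add: \<phi>_def)
  have nb: "nbrs (\<phi> x) = nbrs x" for x using uw by (simp add: \<phi>_def)
  have "bij_betw \<phi> (pverts G) (pverts G)"
    using inv V by (intro bij_betwI[of _ _ _ \<phi>]) auto
  moreover have "(x, y) \<in> parcs G \<longleftrightarrow> (\<phi> x, \<phi> y) \<in> parcs G" for x y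
  proof -
    have "(\<phi> x, \<phi> y) \<in> parcs G \<longleftrightarrow> \<phi> y \<in> nbrs (\<phi> x)" by (simp add: nbrs_def)
    also have "\<dots> \<longleftrightarrow> x \<in> nbrs (\<phi> y)" unfolding nb[of x] by (rule nbrs_sym)
    also have "\<dots> \<longleftrightarrow> y \<in> nbrs x" unfolding nb[of y] by (rule nbrs_sym)
    finally show ?thesis by (simp add: nbrs_def)
  qed
  ultimately have "graph_automorphism G \<phi>" unfolding graph_automorphism_def by blast
  moreover have "\<forall>x\<in>pverts G. f (\<phi> x) = f x" using uw by (simp add: \<phi>_def)
  ultimately have "\<phi> u = u" using f uw unfolding distinguishing_def by blast
  then show ?thesis by (simp add: \<phi>_def)
qed

text \<open>Vertices in the same part are twins and vertices in different parts are adjacent, so all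
  \<open>2 * m\<close> colors are distinct.\<close>

lemma complete_bipartite_needs:
  assumes bip: "complete_bipartite_digraph m m (with_proj G)"
    and dist: "properly_L_distinguishable G (\<lambda>_. {..<k})"
  shows "2 * m \<le> k"
proof -
  obtain U W where UW: "pverts G = U \<union> W" "U \<inter> W = {}" "card U = m" "card W = m"
    "parcs G = U \<times> W \<union> W \<times> U"
    using bip unfolding complete_bipartite_digraph_pair_def by blast
  obtain f where f: "proper_coloring G f" "distinguishing G f" "\<forall>v\<in>pverts G. f v < k"
    using dist unfolding properly_L_distinguishable_def by auto
  have "inj_on f (pverts G)"
  proof (rule inj_onI)
    fix x y assume xy: "x \<in> pverts G" "y \<in> pverts G" "f x = f y"
    have "(x, y) \<notin> parcs G" using f(1) xy(3) unfolding proper_coloring_def by blast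
    then have "nbrs x = nbrs y"
      using xy UW(1,2) unfolding nbrs_def UW(5) by blast
    then show "x = y" using twins_distinguished[OF f(2)] xy by blast
  qed
  moreover have "f ` pverts G \<subseteq> {..<k}" using f(3) by auto
  ultimately have "card (pverts G) \<le> card {..<k}"
    by (intro card_inj_on_le[of f]) auto
  moreover have "card (pverts G) = 2 * m"
    using UW pair_finite_verts by (simp add: card_Un_disjoint)
  ultimately show ?thesis by simp
qed

text \<open>Transports a symmetry of the index cycle to the graph. Asking for an involution gives
  bijectivity, and makes preservation of adjacency in one direction sufficient.\<close>

lemma cycle_symmetry_trivial:
  assumes ce: "cycle_enum n v" and f: "distinguishing G f"
    and \<sigma>: "\<And>i. i < n \<Longrightarrow> \<sigma> i < n \<and> \<sigma> (\<sigma> i) = i \<and>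
      (\<sigma> (Suc i mod n) = Suc (\<sigma> i) mod n \<or> \<sigma> i = Suc (\<sigma> (Suc i mod n)) mod n)"
    and col: "\<And>i. i < n \<Longrightarrow> f (v (\<sigma> i)) = f (v i)" and i: "i < n"
  shows "\<sigma> i = i"
proof -
  have bij: "bij_betw v {..<n} (pverts G)" using ce unfolding cycle_enum_def by blast
  define \<phi> where "\<phi> = v \<circ> \<sigma> \<circ> the_inv_into {..<n} v"
  have \<phi>: "\<phi> (v i) = v (\<sigma> i)" if "i < n" for i
    using that bij unfolding \<phi>_def bij_betw_def by (simp add: the_inv_into_f_f)
  have V: "\<phi> x \<in> pverts G \<and> \<phi> (\<phi> x) = x \<and> f (\<phi> x) = f x" if x: "x \<in> pverts G" for x
  proof -
    obtain i where i: "i < n" "x = v i" using cycle_enum_obtain[OF ce x] .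
    then show ?thesis using \<phi> \<sigma>[of i] col[of i] cycle_enum_in_pverts[OF ce, of "\<sigma> i"] by simp
  qed
  define E where "E i j \<longleftrightarrow> j = Suc i mod n \<or> i = Suc j mod n" for i j
  have E: "E (\<sigma> i) (\<sigma> j)" if "E i j" "i < n" "j < n" for i j
    using that \<sigma>[of i] \<sigma>[of j] unfolding E_def by auto
  have arc: "(x, y) \<in> parcs G \<longleftrightarrow> (\<phi> x, \<phi> y) \<in> parcs G" if xy: "x \<in> pverts G" "y \<in> pverts G" for x y
  proof -
    obtain i where i: "i < n" "x = v i" using cycle_enum_obtain[OF ce xy(1)] .
    obtain j where j: "j < n" "y = v j" using cycle_enum_obtain[OF ce xy(2)] .
    have arcE: "(v i, v j) \<in> parcs G \<longleftrightarrow> E i j" if "i < n" "j < n" for i j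
      using ce that unfolding cycle_enum_def nbrs_def E_def by blast
    have "E i j \<longleftrightarrow> E (\<sigma> i) (\<sigma> j)"
      using E[of i j] E[of "\<sigma> i" "\<sigma> j"] \<sigma>[OF i(1)] \<sigma>[OF j(1)] i j by auto
    then show ?thesis using arcE \<phi> \<sigma>[OF i(1)] \<sigma>[OF j(1)] i j by simp
  qed
  have "bij_betw \<phi> (pverts G) (pverts G)"
    using V by (intro bij_betwI[of _ _ _ \<phi>]) auto
  then have "graph_automorphism G \<phi>" using arc unfolding graph_automorphism_def by blast
  then have "\<phi> (v i) = v i"
    using f V cycle_enum_in_pverts[OF ce i] unfolding distinguishing_def by blast
  then show ?thesis using \<phi>[OF i] cycle_enum_eq_iff[OF ce _ i] \<sigma>[OF i] by simp
qed

text \<open>Each symmetry found in a proper three-coloring of the hexagon is a nontrivial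
  automorphism preserving colors.\<close>

lemma hexagon_needs:
  fixes k :: nat
  assumes ce: "cycle_enum 6 v" and dist: "properly_L_distinguishable G (\<lambda>_. {..<k})"
  shows "4 \<le> k"
proof (rule ccontr)
  assume "\<not> 4 \<le> k"
  then have k: "k \<le> 3" by simp
  obtain f where f: "proper_coloring G f" "distinguishing G f" and fk: "\<forall>v\<in>pverts G. f v \<in> {..<k}"
    using dist unfolding properly_L_distinguishable_def by blast
  have lt: "f (v i) < 3" if "i < 6" for i
    using fk cycle_enum_in_pverts[OF ce that] k by fastforce
  have proper: "f (v i) \<noteq> f (v j)" if "i < 6" "j < 6" "j = Suc i \<or> j = 0 \<and> i = 5" for i j
  proof -
    have "(v i, v j) \<in> parcs G"
      using cycle_enum_nbrs_iff[OF ce that(1,2)] that(3) unfolding nbrs_def by auto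
    then show ?thesis using f(1) unfolding proper_coloring_def by blast
  qed
  have six: "i = 0 \<or> i = 1 \<or> i = 2 \<or> i = 3 \<or> i = 4 \<or> i = 5" if "i < 6" for i :: nat
    using that by linarith
  have no: False if "\<And>i. i < 6 \<Longrightarrow> \<sigma> i < 6 \<and> \<sigma> (\<sigma> i) = i \<and>
      (\<sigma> (Suc i mod 6) = Suc (\<sigma> i) mod 6 \<or> \<sigma> i = Suc (\<sigma> (Suc i mod 6)) mod 6)"
    "\<And>i. i < 6 \<Longrightarrow> f (v (\<sigma> i)) = f (v i)" "j < 6" "\<sigma> j \<noteq> j" for \<sigma> j
    using cycle_symmetry_trivial[OF ce f(2) that(1,2,3)] that(4) by blast
  \<comment> \<open>The values 6, 8 and 10 of \<open>k\<close> give the reflections taking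
    \<open>i\<close> to \<open>-i\<close>, \<open>2 - i\<close> and \<open>4 - i\<close> modulo 6;
    the shift by 6 avoids truncated subtraction.\<close>
  define refl where "refl k i = (k - i) mod 6" for k i :: nat
  have refl: "refl k i < 6 \<and> refl k (refl k i) = i \<and>
      (refl k (Suc i mod 6) = Suc (refl k i) mod 6 \<or> refl k i = Suc (refl k (Suc i mod 6)) mod 6)"
    if "i < 6" "k = 6 \<or> k = 8 \<or> k = 10" for k i
    using six[OF that(1)] that(2) unfolding refl_def by (elim disjE) simp_all
  have "\<not> (f (v 1) = f (v 5) \<and> f (v 2) = f (v 4))"
  proof
    assume c: "f (v 1) = f (v 5) \<and> f (v 2) = f (v 4)"
    have "f (v (refl 6 i)) = f (v i)" if "i < 6" for i
      using six[OF that] c by (elim disjE) (simp_all add: refl_def)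
    then show False using no[of "refl 6" 1] refl[of _ 6] by (simp add: refl_def)
  qed
  moreover have "\<not> (f (v 0) = f (v 2) \<and> f (v 5) = f (v 3))"
  proof
    assume c: "f (v 0) = f (v 2) \<and> f (v 5) = f (v 3)"
    have "f (v (refl 8 i)) = f (v i)" if "i < 6" for i
      using six[OF that] c by (elim disjE) (simp_all add: refl_def)
    then show False using no[of "refl 8" 0] refl[of _ 8] by (simp add: refl_def)
  qed
  moreover have "\<not> (f (v 1) = f (v 3) \<and> f (v 0) = f (v 4))"
  proof
    assume c: "f (v 1) = f (v 3) \<and> f (v 0) = f (v 4)"
    have "f (v (refl 10 i)) = f (v i)" if "i < 6" for i
      using six[OF that] c by (elim disjE) (simp_all add: refl_def)
    then show False using no[of "refl 10" 0] refl[of _ 10] by (simp add: refl_def)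
  qed
  moreover have "\<not> (f (v 0) = f (v 3) \<and> f (v 1) = f (v 4) \<and> f (v 2) = f (v 5))"
  proof
    assume c: "f (v 0) = f (v 3) \<and> f (v 1) = f (v 4) \<and> f (v 2) = f (v 5)"
    define \<sigma> where "\<sigma> i = (i + 3) mod 6" for i :: nat
    have "f (v (\<sigma> i)) = f (v i)" if "i < 6" for i
      using six[OF that] c by (elim disjE) (simp_all add: \<sigma>_def)
    moreover have "\<sigma> i < 6 \<and> \<sigma> (\<sigma> i) = i \<and>
      (\<sigma> (Suc i mod 6) = Suc (\<sigma> i) mod 6 \<or> \<sigma> i = Suc (\<sigma> (Suc i mod 6)) mod 6)" if "i < 6" for i
      using six[OF that] by (elim disjE) (simp_all add: \<sigma>_def)
    ultimately show False using no[of \<sigma> 0] by (simp add: \<sigma>_def)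
  qed
  moreover have "f (v 0) < 3" "f (v 1) < 3" "f (v 2) < 3" "f (v 3) < 3" "f (v 4) < 3" "f (v 5) < 3"
    using lt by auto
  moreover have "f (v 0) \<noteq> f (v 1)" "f (v 1) \<noteq> f (v 2)" "f (v 2) \<noteq> f (v 3)" "f (v 3) \<noteq> f (v 4)"
    "f (v 4) \<noteq> f (v 5)" "f (v 5) \<noteq> f (v 0)"
    using proper by auto
  ultimately show False
    using three_coloring_of_hexagon_symmetric[of "f (v 0)" "f (v 1)" "f (v 2)" "f (v 3)" "f (v 4)" "f (v 5)"]
    by blast
qed

section \<open>Combining the upper and lower bounds\<close>

lemma max_deg_of_regular:
  assumes "\<And>v. v \<in> pverts G \<Longrightarrow> card (nbrs v) = d"
  shows "max_deg = d"
proof -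
  have "(\<lambda>v. card (nbrs v)) ` pverts G = {d}" using assms pverts_nonempty by auto
  then show ?thesis by (simp add: max_deg_nbrs)
qed

text \<open>Removes degree 1 from the upper bound, where \<open>2 * max_deg - 1\<close> does not
  exceed \<open>max_deg\<close> and the root with its neighbors could not be colored
  greedily.\<close>

lemma complete_bipartite_of_max_deg_1:
  assumes D: "max_deg = 1"
  shows "complete_bipartite_digraph 1 1 (with_proj G)"
proof -
  have "max_deg \<in> (\<lambda>v. card (nbrs v)) ` pverts G"
    unfolding max_deg_nbrs using pair_finite_verts pverts_nonempty by (intro Max_in) auto
  then obtain r where r: "r \<in> pverts G" "card (nbrs r) = 1" using D by auto
  then obtain x where x: "nbrs r = {x}" using card_1_singletonE by blast
  have xV: "x \<in> pverts G" "r \<in> nbrs x" using x in_nbrsD(1)[of x r] nbrs_sym[of r x] by auto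
  have "card (nbrs x) \<le> 1" using card_nbrs_le[OF xV(1)] D by simp
  then have nx: "nbrs x = {r}"
    using xV(2) card_le_Suc0_iff_eq[of "nbrs x"] by auto
  have V: "{r, x} = pverts G"
    using closed_under_nbrs[of r "{r, x}"] x nx r xV by auto
  have rx: "r \<noteq> x" using x by auto
  have "parcs G = {r} \<times> {x} \<union> {x} \<times> {r}"
  proof -
    have "(u, w) \<in> parcs G \<longleftrightarrow> u = r \<and> w = x \<or> u = x \<and> w = r" for u w
    proof -
      have "(u, w) \<in> parcs G \<longleftrightarrow> w \<in> nbrs u" by (simp add: nbrs_def)
      moreover have "w \<in> nbrs u \<Longrightarrow> u = r \<or> u = x" using V in_nbrsD(2) by blast
      ultimately show ?thesis using x nx by auto
    qed
    then show ?thesis by auto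
  qed
  moreover have "pverts G = {r} \<union> {x}" "{r} \<inter> {x} = {}" "card {r} = 1" "card {x} = 1"
    using V rx by auto
  ultimately show ?thesis
    unfolding complete_bipartite_digraph_pair_def using pair_finite_verts by metis
qed

text \<open>A vertex of degree below \<open>max_deg\<close> serves as root in the slack case;
  otherwise the graph is regular, and it is a cycle or has degree at least 3.\<close>

lemma list_dist_chromatic_number_le:
  assumes D: "1 \<le> max_deg"
    and not_bip: "\<not> complete_bipartite_digraph max_deg max_deg (with_proj G)"
    and not_C6: "\<not> digraph_iso (with_proj G) (with_proj (cycle_graph 6))"
  shows "list_dist_chromatic_number G \<le> 2 * max_deg - 1"
  unfolding list_dist_chromatic_number_lists
proof (intro Least_le allI impI)
  fix L assume L: "lists_of_size (2 * max_deg - 1) L"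
  have "max_deg \<noteq> 1" using complete_bipartite_of_max_deg_1 not_bip by auto
  then have D2: "2 \<le> max_deg" using D by simp
  show "properly_L_distinguishable G L"
  proof (cases "\<exists>r\<in>pverts G. card (nbrs r) \<noteq> max_deg")
    case True
    then obtain r where r: "r \<in> pverts G" "card (nbrs r) < max_deg"
      using card_nbrs_le le_neq_implies_less by blast
    then show ?thesis using distinguishable_of_slack[OF L r(1)] D2 by simp
  next
    case False
    then have reg: "card (nbrs v) = max_deg" if "v \<in> pverts G" for v using that by blast
    show ?thesis
    proof (cases "max_deg = 2")
      case True
      then show ?thesis using distinguishable_of_2_regular L reg not_bip not_C6 by simp
    next
      case False
      then show ?thesis using distinguishable_of_regular[OF L _ reg not_bip] D2 by simp
    qed
  qed
qed

text \<open>With \<open>2 * max_deg\<close> colors there is always one to spare, and constant lists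
  bound every admissible \<open>k\<close> from below.\<close>

lemma list_dist_chromatic_number_eq:
  assumes D: "1 \<le> max_deg"
    and needs: "\<And>k. properly_L_distinguishable G (\<lambda>_. {..<k}) \<Longrightarrow> 2 * max_deg \<le> k"
  shows "list_dist_chromatic_number G = 2 * max_deg"
  unfolding list_dist_chromatic_number_lists
proof (rule Least_equality, intro allI impI)
  fix L assume L: "lists_of_size (2 * max_deg) L"
  obtain r where "r \<in> pverts G" using pverts_nonempty by blast
  then show "properly_L_distinguishable G L" using distinguishable_of_slack[OF L] D by simp
next
  fix k assume k: "\<forall>L. lists_of_size k L \<longrightarrow> properly_L_distinguishable G L"
  have "lists_of_size k (\<lambda>_. {..<k})" by (simp add: lists_of_size_def)
  then show "2 * max_deg \<le> k" using k needs by blast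
qed

end

theorem theorem3p1:
  fixes G :: "'a pair_pre_digraph"
  assumes "pair_graph G"
    and "Digraph_Component.connected (with_proj G)"
    and "max_degree G \<ge> 1"
  shows "(\<not> (complete_bipartite_digraph (max_degree G) (max_degree G) (with_proj G) \<or>
             digraph_iso (with_proj G) (with_proj (cycle_graph 6)))
          \<longrightarrow> list_dist_chromatic_number G \<le> 2 * max_degree G - 1) \<and>
         (complete_bipartite_digraph (max_degree G) (max_degree G) (with_proj G) \<or>
             digraph_iso (with_proj G) (with_proj (cycle_graph 6))
          \<longrightarrow> list_dist_chromatic_number G = 2 * max_degree G)"
proof -
  interpret connected_pair_graph G
    using assms(1,2) by (intro connected_pair_graph.intro connected_pair_graph_axioms.intro)
  \<comment> \<open>Only the lower bound in the exceptional cases remains. The hexagon is 2-regular,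
    so the four colors it needs are \<open>2 * max_degree G\<close>.\<close>
  have "2 * max_degree G \<le> k"
    if exceptional: "complete_bipartite_digraph (max_degree G) (max_degree G) (with_proj G) \<or>
      digraph_iso (with_proj G) (with_proj (cycle_graph 6))"
      and k: "properly_L_distinguishable G (\<lambda>_. {..<k})" for k
    using exceptional
  proof
    assume "complete_bipartite_digraph (max_degree G) (max_degree G) (with_proj G)"
    then show ?thesis using complete_bipartite_needs k by blast
  next
    assume "digraph_iso (with_proj G) (with_proj (cycle_graph 6))"
    then obtain v where ce: "cycle_enum 6 v" by (rule iso_cycle_enum) simp_all
    then have "max_degree G = 2" using cycle_enum_degree max_deg_of_regular by blast
    then show ?thesis using hexagon_needs[OF ce k] by simp
  qed
  then show ?thesis
    using list_dist_chromatic_number_le list_dist_chromatic_number_eq assms(3) by blast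
qed

end
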